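(* Suppose that $\Gamma$ is finite and that $f_\gamma(0)=0$ for every $\gamma\in\Gamma$ such that $0\in\chi_\gamma$. Let $\mathcal{T}$ be a family of forward complete trajectories of $\dot x=f(x,\sigma)$ such that $\sigma\in\mathcal{S}_d\cap\mathcal{S}^H$ for every $(x,\sigma)\in\mathcal{T}$, where $H:\Gamma\rightsquigarrow\Gamma$ is a set-valued map. For a pair $(V,W)$ consider the conditions (i) $\mathcal{O}_\gamma^f(f_\gamma,W_\gamma,\infty)\subset\{0\}$ for every $\gamma\in\Gamma$, or $\mathcal{O}_\gamma^b(f_\gamma,W_\gamma,\infty)\subset\{0\}$ for every $\gamma\in\Gamma$; (ii) for each simple cycle $\{\gamma_i\}_{i=1}^m$ of $H$ there exists $j\in\{1,\ldots,m-1\}$ such that $\mathcal{O}_{\gamma_j}^b(f_{\gamma_j},W_{\gamma_j})\cap\mathcal{O}_{\gamma_{j+1}}^f(f_{\gamma_{j+1}},W_{\gamma_{j+1}})\subset\{0\}$; (iii) for every $c\in\mathbb{R}$ and for each simple cycle $\{\gamma_i\}_{i=1}^m$ of $H$ there exists $j\in\{1,\ldots,m-1\}$ such that $\mathcal{O}_{\gamma_j}^b(f_{\gamma_j},W_{\gamma_j})\cap\mathcal{O}_{\gamma_{j+1}}^f(f_{\gamma_{j+1}},W_{\gamma_{j+1}})\cap V_{\gamma_j}^{-1}(c)\cap V_{\gamma_{j+1}}^{-1}(c)\subset\{0\}$. Then $\mathcal{T}$ is locally asymptotically stable (LAS) if one of the following holds: 1. there exists a weak Lyapunov pair $(V,W)$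 for $\mathcal{T}$ such that (i) and (iii) hold; 2. there exists an F-weak Lyapunov pair $(V,W)$ for $\mathcal{T}$ such that (i) and (ii) hold. If, in addition, $\mathcal{O}=\mathbb{R}^n$ and $V$ is radially unbounded, then $\mathcal{T}$ is globally asymptotically stable (GAS).
   Context: Setting: $\Gamma$ is a compact metric space (here finite), $\mathrm{dom}(f)\subset\mathbb{R}^n\times\Gamma$ is closed and $f:\mathrm{dom}(f)\to\mathbb{R}^n$ is continuous. For $\gamma\in\Gamma$, $\chi_\gamma=\{\xi\in\mathbb{R}^n:(\xi,\gamma)\in\mathrm{dom}(f)\}$ and $f_\gamma:\chi_\gamma\to\mathbb{R}^n$, $f_\gamma(\xi)=f(\xi,\gamma)$. A switching signal is a function $\sigma:\mathbb{R}\to\Gamma$ that is piecewise constant (at most finitely many jumps in each compact interval) and continuous from the right; $\Lambda(\sigma)$ is the set of times at which $\sigma$ has a jump. A solution of $\dot x=f(x,\sigma)$ corresponding to $\sigma$ is a locally absolutely continuous $x:I_x\to\mathbb{R}^n$, $I_x\subset\mathbb{R}$ a nonempty interval, with $(x(t),\sigma(t))\in\mathrm{dom}(f)$ for all $t\in I_x$ and $\dot x(t)=f(x(t),\sigma(t))$ for almost all $t\in I_x$. Then $(x,\sigma)$ is called a trajectory; it is forward complete if $\mathbb{R}_{\ge0}\subset I_x$. $\mathcal{S}_d=\bigcup_{\tau_D>0}\mathcal{S}_d[\tau_D]$, where $\mathcal{S}_d[\tau_D]$ is the set of switching signals with $|t-t'|\ge\tau_D$ for all $t\ne t'$ in $\Lambda(\sigma)$.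 For a set-valued map $H:\Gamma\rightsquigarrow\Gamma$, $\mathcal{S}^H$ is the set of switching signals $\sigma$ with $\sigma(t)\in H(\sigma(t^-))$ for every $t\in\Lambda(\sigma)$, where $\sigma(t^-)=\lim_{s\to t^-}\sigma(s)$. A finite sequence $\{\gamma_i\}_{i=1}^m\subset\Gamma$, $m\ge3$, is a simple cycle of $H$ if $\gamma_1=\gamma_m$, $\gamma_{i+1}\in H(\gamma_i)$ for all $i=1,\ldots,m-1$, and if $\gamma_i=\gamma_j$ and $i<j$ then $i=1$ and $j=m$. $\pi_1:\mathbb{R}^n\times\Gamma\to\mathbb{R}^n$ is the projection onto the first component. Class $\mathcal{V}$: $V:\mathrm{dom}(V)\to\mathbb{R}$ belongs to $\mathcal{V}$ if $\mathrm{dom}(V)\subset\mathbb{R}^n\times\Gamma$; for every $\gamma\in\Gamma$ the set $\mathcal{D}_\gamma=\{\xi:(\xi,\gamma)\in\mathrm{dom}(V)\}$ is open; with $\mathcal{O}=\pi_1(\mathrm{dom}(V))$ and $\mathcal{O}_\gamma=\mathcal{O}\cap\chi_\gamma$, one has $\mathcal{O}_\gamma\subset\mathcal{D}_\gamma$ for all $\gamma$; and for all $\gamma$, $V_\gamma(\cdot)=V(\cdot,\gamma)$ is differentiable on $\mathcal{O}_\gamma$. ($\mathcal{O}$ and $\mathcal{O}_\gamma$ always refer to the function $V$ under consideration.) Observability-like sets: given $\mathcal{X}\subset\mathbb{R}^n$, a continuous map $g:\mathcal{X}\to\mathbb{R}^n$, a function $h:\mathcal{X}\to\mathbb{R}$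 and $\tau>0$ or $\tau=\infty$, $\mathcal{X}^f(g,h,\tau)$ (resp. $\mathcal{X}^b(g,h,\tau)$) is the set of $\xi\in\mathcal{X}$ for which there is a solution $\varphi:[0,\tau]\to\mathcal{X}$ (resp. $\varphi:[-\tau,0]\to\mathcal{X}$) of $\dot x=g(x)$ with $\varphi(0)=\xi$ and $h(\varphi(t))=0$ for all $t\in[0,\tau]$ (resp. $t\in[-\tau,0]$); for $\tau=\infty$ the intervals are $[0,\infty)$ and $(-\infty,0]$. Also $\mathcal{X}^f(g,h)=\bigcup_{\tau>0}\mathcal{X}^f(g,h,\tau)$ and $\mathcal{X}^b(g,h)=\bigcup_{\tau>0}\mathcal{X}^b(g,h,\tau)$. The sets $\mathcal{O}_\gamma^{f}(f_\gamma,W_\gamma)$, $\mathcal{O}_\gamma^{b}(f_\gamma,W_\gamma)$, $\mathcal{O}_\gamma^{f}(f_\gamma,W_\gamma,\infty)$, $\mathcal{O}_\gamma^{b}(f_\gamma,W_\gamma,\infty)$ are these sets with $\mathcal{X}=\mathcal{O}_\gamma$, $g=f_\gamma|_{\mathcal{O}_\gamma}$, $h=W_\gamma:=W(\cdot,\gamma)$. Comparison functions: a class $\mathcal{K}$ function is $\alpha:[0,r]\to\mathbb{R}_{\ge0}$ strictly increasing, continuous, with $\alpha(0)=0$; a class $\mathcal{K}_\infty$ function is one with $r=+\infty$ (domain $[0,\infty)$) that is in addition unbounded. Stability: a family $\mathcal{T}$ of forward complete trajectories is: LUS if there exist $r>0$ and $\alpha:[0,r]\to\mathbb{R}$ of class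 $\mathcal{K}$ such that for all $(x,\sigma)\in\mathcal{T}$ and all $t_0\ge0$, $|x(t_0)|\le r$ implies $|x(t)|\le\alpha(|x(t_0)|)$ for all $t\ge t_0$; GUS if there exists $\alpha:[0,\infty)\to\mathbb{R}$ of class $\mathcal{K}_\infty$ such that for all $(x,\sigma)\in\mathcal{T}$, $|x(t)|\le\alpha(|x(t_0)|)$ for all $t\ge t_0\ge0$; LAS (locally asymptotically stable) if it is LUS and there exists $\eta>0$ such that $\lim_{t\to+\infty}x(t)=0$ for all $(x,\sigma)\in\mathcal{T}$ with $|x(0)|<\eta$; GAS (globally asymptotically stable) if it is GUS and $\lim_{t\to+\infty}x(t)=0$ for all $(x,\sigma)\in\mathcal{T}$. Lyapunov pairs: $(V,W)$ is a weak Lyapunov pair for $\mathcal{T}$ if: (1) $V\in\mathcal{V}$, $0\in\mathcal{O}$ and there exist functions $\alpha_1,\alpha_2$ of class $\mathcal{K}$ (with domains containing the values $|\xi|$ involved) such that $\alpha_1(|\xi|)\le V(\xi,\gamma)\le\alpha_2(|\xi|)$ for all $\xi\in\mathcal{O}_\gamma$, $\gamma\in\Gamma$; (2) $W:\mathrm{dom}(f)\cap(\mathcal{O}\times\Gamma)\to\mathbb{R}$ satisfies, with $W_\gamma(\cdot)=W(\cdot,\gamma)$, $-\nabla V_\gamma(\xi)f_\gamma(\xi)\ge W_\gamma(\xi)\ge0$ for all $\xi\in\mathcal{O}_\gamma$, $\gamma\in\Gamma$; (3) for every $(x,\sigma)\in\mathcal{T}$, if $x(t)\in\mathcal{O}$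 for all $t\in[a,b]\subset[0,+\infty)$ then $v(t)=V(x(t),\sigma(t))$ is nonincreasing on $[a,b]$. It is an F-weak Lyapunov pair for $\mathcal{T}$ if (1) and (2) hold and: (4) for every $(x,\sigma)\in\mathcal{T}$, if $x(t)\in\mathcal{O}$ for all $t\in[a,b]\subset[0,+\infty)$ then for every $\gamma\in\Gamma$, $v(t)=V(x(t),\gamma)$ is nonincreasing on $[a,b]\cap\sigma^{-1}(\gamma)$. $V$ is radially unbounded if the inequality in (1) holds for some $\alpha_1,\alpha_2$ of class $\mathcal{K}_\infty$. *)

theory Defs
  imports "HOL-Analysis.Analysis"
begin

text \<open>
  Conventions.  The state space \<open>\<real>\<^sup>n\<close> is a type \<^typ>\<open>'a::euclidean_space\<close>, and the index space
  \<open>\<Gamma>\<close> is a whole type \<^typ>\<open>'g::metric_space\<close>.  A partial function is a pair of a domain and a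
  total function of which only the values on the domain are ever used: \<open>f : dom(f) \<rightarrow> \<real>\<^sup>n\<close> is given
  by \<open>Df\<close> and \<open>f\<close>, \<open>V : dom(V) \<rightarrow> \<real>\<close> by \<open>DV\<close> and \<open>V\<close>, and a curve \<open>x : I\<^sub>x \<rightarrow> \<real>\<^sup>n\<close> by \<open>I\<close> and \<open>x\<close>.
  The domain of \<open>W\<close> is always \<open>dom(f) \<inter> (\<O> \<times> \<Gamma>)\<close>, so it is not carried along.
\<close>

definition jump_times :: "(real \<Rightarrow> 'g::metric_space) \<Rightarrow> real set"
  where "jump_times \<sigma> = {t. \<not> isCont \<sigma> t}"

definition switching_signal :: "(real \<Rightarrow> 'g::metric_space) \<Rightarrow> bool"
  where "switching_signal \<sigma> \<longleftrightarrow>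
    (\<forall>a b. finite (jump_times \<sigma> \<inter> {a..b})) \<and>
    (\<forall>s t. s \<le> t \<and> jump_times \<sigma> \<inter> {s..t} = {} \<longrightarrow> \<sigma> s = \<sigma> t) \<and>
    (\<forall>t. continuous (at_right t) \<sigma>)"

definition signals_dwell :: "real \<Rightarrow> (real \<Rightarrow> 'g::metric_space) set"
  where "signals_dwell \<tau> = {\<sigma>. switching_signal \<sigma> \<and>
    (\<forall>t\<in>jump_times \<sigma>. \<forall>t'\<in>jump_times \<sigma>. t \<noteq> t' \<longrightarrow> \<bar>t - t'\<bar> \<ge> \<tau>)}"

definition signals_d :: "(real \<Rightarrow> 'g::metric_space) set"
  where "signals_d = (\<Union>\<tau>\<in>{0<..}. signals_dwell \<tau>)"

definition signals_H :: "('g \<Rightarrow> 'g set) \<Rightarrow> (real \<Rightarrow> 'g::metric_space) set"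
  where "signals_H H = {\<sigma>. switching_signal \<sigma> \<and>
    (\<forall>t\<in>jump_times \<sigma>. \<sigma> t \<in> H (Lim (at_left t) \<sigma>))}"

text \<open>A simple cycle \<open>\<gamma>\<^sub>1, \<dots>, \<gamma>\<^sub>m\<close>; the values of \<open>\<gamma>\<close> outside \<open>{1..m}\<close> are irrelevant.\<close>

definition simple_cycle :: "('g \<Rightarrow> 'g set) \<Rightarrow> nat \<Rightarrow> (nat \<Rightarrow> 'g) \<Rightarrow> bool"
  where "simple_cycle H m \<gamma> \<longleftrightarrow> 3 \<le> m \<and> \<gamma> 1 = \<gamma> m \<and>
    (\<forall>i\<in>{1..m-1}. \<gamma> (i + 1) \<in> H (\<gamma> i)) \<and>
    (\<forall>i\<in>{1..m}. \<forall>j\<in>{1..m}. \<gamma> i = \<gamma> j \<and> i < j \<longrightarrow> i = 1 \<and> j = m)"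

text \<open>The usual \<open>\<epsilon>\<close>-\<open>\<delta>\<close> notion; \<open>P\<close> is a finite family of non-overlapping subintervals
  \<open>[s, t]\<close> of \<open>[a, b]\<close>, each given by the pair of its endpoints.\<close>

definition abs_cont_on_interval :: "real \<Rightarrow> real \<Rightarrow> (real \<Rightarrow> 'a::real_normed_vector) \<Rightarrow> bool"
  where "abs_cont_on_interval a b x \<longleftrightarrow>
    (\<forall>\<epsilon>>0. \<exists>\<delta>>0. \<forall>P :: (real \<times> real) set.
      finite P \<and> (\<forall>(s, t)\<in>P. a \<le> s \<and> s < t \<and> t \<le> b) \<and>
      (\<forall>(s, t)\<in>P. \<forall>(s', t')\<in>P. (s, t) \<noteq> (s', t') \<longrightarrow> {s<..<t} \<inter> {s'<..<t'} = {}) \<and>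
      (\<Sum>(s, t)\<in>P. t - s) < \<delta>
      \<longrightarrow> (\<Sum>(s, t)\<in>P. norm (x t - x s)) < \<epsilon>)"

definition locally_abs_cont_on :: "real set \<Rightarrow> (real \<Rightarrow> 'a::real_normed_vector) \<Rightarrow> bool"
  where "locally_abs_cont_on I x \<longleftrightarrow> (\<forall>a b. {a..b} \<subseteq> I \<longrightarrow> abs_cont_on_interval a b x)"

text \<open>The curve \<open>x : I \<rightarrow> \<real>\<^sup>n\<close> is locally absolutely continuous and has derivative \<open>y(t)\<close> at almost
  every \<open>t \<in> I\<close>.  It is used with \<open>y(t) = f(x(t), \<sigma>(t))\<close> and with \<open>y(t) = g(x(t))\<close>.\<close>

definition has_ae_derivative_on ::
    "real set \<Rightarrow> (real \<Rightarrow> 'a::euclidean_space) \<Rightarrow> (real \<Rightarrow> 'a) \<Rightarrow> bool"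
  where "has_ae_derivative_on I x y \<longleftrightarrow>
    I \<noteq> {} \<and> is_interval I \<and> locally_abs_cont_on I x \<and>
    (AE t in lebesgue. t \<in> I \<longrightarrow> (x has_vector_derivative y t) (at t within I))"

type_synonym ('a, 'g) traj = "real set \<times> (real \<Rightarrow> 'a) \<times> (real \<Rightarrow> 'g)"

definition trajectory ::
    "('a::euclidean_space \<times> 'g::metric_space) set \<Rightarrow> ('a \<times> 'g \<Rightarrow> 'a) \<Rightarrow> ('a, 'g) traj \<Rightarrow> bool"
  where "trajectory Df f = (\<lambda>(I, x, \<sigma>). switching_signal \<sigma> \<and>
    (\<forall>t\<in>I. (x t, \<sigma> t) \<in> Df) \<and>
    has_ae_derivative_on I x (\<lambda>t. f (x t, \<sigma> t)))"

definition forward_complete :: "('a, 'g) traj \<Rightarrow> bool"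
  where "forward_complete = (\<lambda>(I, x, \<sigma>). {0..} \<subseteq> I)"

text \<open>The horizon \<open>\<tau>\<close> is an extended real, so that for \<open>\<tau> = \<infinity>\<close> the time interval is
  \<open>[0, \<infinity>)\<close>, respectively \<open>(-\<infinity>, 0]\<close>.\<close>

definition obs_fwd_upto ::
    "'a::euclidean_space set \<Rightarrow> ('a \<Rightarrow> 'a) \<Rightarrow> ('a \<Rightarrow> real) \<Rightarrow> ereal \<Rightarrow> 'a set"
  where "obs_fwd_upto X g h \<tau> = {\<xi>\<in>X. \<exists>\<phi>.
    has_ae_derivative_on {t. 0 \<le> t \<and> ereal t \<le> \<tau>} \<phi> (\<lambda>t. g (\<phi> t)) \<and> \<phi> 0 = \<xi> \<and>
    (\<forall>t. 0 \<le> t \<and> ereal t \<le> \<tau> \<longrightarrow> \<phi> t \<in> X \<and> h (\<phi> t) = 0)}"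

definition obs_bwd_upto ::
    "'a::euclidean_space set \<Rightarrow> ('a \<Rightarrow> 'a) \<Rightarrow> ('a \<Rightarrow> real) \<Rightarrow> ereal \<Rightarrow> 'a set"
  where "obs_bwd_upto X g h \<tau> = {\<xi>\<in>X. \<exists>\<phi>.
    has_ae_derivative_on {t. - \<tau> \<le> ereal t \<and> t \<le> 0} \<phi> (\<lambda>t. g (\<phi> t)) \<and> \<phi> 0 = \<xi> \<and>
    (\<forall>t. - \<tau> \<le> ereal t \<and> t \<le> 0 \<longrightarrow> \<phi> t \<in> X \<and> h (\<phi> t) = 0)}"

definition obs_fwd :: "'a::euclidean_space set \<Rightarrow> ('a \<Rightarrow> 'a) \<Rightarrow> ('a \<Rightarrow> real) \<Rightarrow> 'a set"
  where "obs_fwd X g h = (\<Union>\<tau>\<in>{0<..}. obs_fwd_upto X g h (ereal \<tau>))"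

definition obs_bwd :: "'a::euclidean_space set \<Rightarrow> ('a \<Rightarrow> 'a) \<Rightarrow> ('a \<Rightarrow> real) \<Rightarrow> 'a set"
  where "obs_bwd X g h = (\<Union>\<tau>\<in>{0<..}. obs_bwd_upto X g h (ereal \<tau>))"

text \<open>\<open>A\<close> is the domain of \<open>\<alpha>\<close>, either \<open>[0, r]\<close> with \<open>0 < r < \<infinity>\<close> or \<open>[0, \<infinity>)\<close>.
  Nonnegativity of \<open>\<alpha>\<close> on \<open>A\<close> follows from monotonicity and \<open>\<alpha>(0) = 0\<close>.\<close>

definition class_K :: "real set \<Rightarrow> (real \<Rightarrow> real) \<Rightarrow> bool"
  where "class_K A \<alpha> \<longleftrightarrow> ((\<exists>r>0. A = {0..r}) \<or> A = {0..}) \<and>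
    strict_mono_on A \<alpha> \<and> continuous_on A \<alpha> \<and> \<alpha> 0 = 0"

definition class_K_inf :: "(real \<Rightarrow> real) \<Rightarrow> bool"
  where "class_K_inf \<alpha> \<longleftrightarrow> class_K {0..} \<alpha> \<and> \<not> bounded (\<alpha> ` {0..})"

definition LUS :: "('a::euclidean_space, 'g) traj set \<Rightarrow> bool"
  where "LUS \<T> \<longleftrightarrow> (\<exists>r>0. \<exists>\<alpha>. class_K {0..r} \<alpha> \<and>
    (\<forall>(I, x, \<sigma>)\<in>\<T>. \<forall>t\<^sub>0\<ge>0. norm (x t\<^sub>0) \<le> r \<longrightarrow>
      (\<forall>t\<ge>t\<^sub>0. norm (x t) \<le> \<alpha> (norm (x t\<^sub>0)))))"

definition GUS :: "('a::euclidean_space, 'g) traj set \<Rightarrow> bool"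
  where "GUS \<T> \<longleftrightarrow> (\<exists>\<alpha>. class_K_inf \<alpha> \<and>
    (\<forall>(I, x, \<sigma>)\<in>\<T>. \<forall>t\<^sub>0\<ge>0. \<forall>t\<ge>t\<^sub>0. norm (x t) \<le> \<alpha> (norm (x t\<^sub>0))))"

definition LAS :: "('a::euclidean_space, 'g) traj set \<Rightarrow> bool"
  where "LAS \<T> \<longleftrightarrow> LUS \<T> \<and>
    (\<exists>\<eta>>0. \<forall>(I, x, \<sigma>)\<in>\<T>. norm (x 0) < \<eta> \<longrightarrow> (x \<longlongrightarrow> 0) at_top)"

definition GAS :: "('a::euclidean_space, 'g) traj set \<Rightarrow> bool"
  where "GAS \<T> \<longleftrightarrow> GUS \<T> \<and> (\<forall>(I, x, \<sigma>)\<in>\<T>. (x \<longlongrightarrow> 0) at_top)"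

text \<open>\<open>slice Df \<gamma>\<close> is \<open>\<chi>\<^sub>\<gamma>\<close> and \<open>slice DV \<gamma>\<close> is \<open>\<D>\<^sub>\<gamma>\<close>; \<open>base DV\<close> is \<open>\<O>\<close> and
  \<open>mode_base Df DV \<gamma>\<close> is \<open>\<O>\<^sub>\<gamma>\<close>.\<close>

definition slice :: "('a \<times> 'g) set \<Rightarrow> 'g \<Rightarrow> 'a set"
  where "slice D \<gamma> = {\<xi>. (\<xi>, \<gamma>) \<in> D}"

definition base :: "('a \<times> 'g) set \<Rightarrow> 'a set"
  where "base DV = fst ` DV"

definition mode_base :: "('a \<times> 'g) set \<Rightarrow> ('a \<times> 'g) set \<Rightarrow> 'g \<Rightarrow> 'a set"
  where "mode_base Df DV \<gamma> = base DV \<inter> slice Df \<gamma>"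

definition class_V ::
    "('a::euclidean_space \<times> 'g::metric_space) set \<Rightarrow> ('a \<times> 'g) set \<Rightarrow> ('a \<times> 'g \<Rightarrow> real) \<Rightarrow> bool"
  where "class_V Df DV V \<longleftrightarrow>
    (\<forall>\<gamma>. open (slice DV \<gamma>)) \<and>
    (\<forall>\<gamma>. mode_base Df DV \<gamma> \<subseteq> slice DV \<gamma>) \<and>
    (\<forall>\<gamma>. \<forall>\<xi>\<in>mode_base Df DV \<gamma>. (\<lambda>\<zeta>. V (\<zeta>, \<gamma>)) differentiable (at \<xi>))"

definition sandwiched ::
    "('a::euclidean_space \<times> 'g::metric_space) set \<Rightarrow> ('a \<times> 'g) set \<Rightarrow> ('a \<times> 'g \<Rightarrow> real) \<Rightarrow>
     real set \<Rightarrow> (real \<Rightarrow> real) \<Rightarrow> real set \<Rightarrow> (real \<Rightarrow> real) \<Rightarrow> bool"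
  where "sandwiched Df DV V A\<^sub>1 \<alpha>\<^sub>1 A\<^sub>2 \<alpha>\<^sub>2 \<longleftrightarrow> (\<forall>\<gamma>. \<forall>\<xi>\<in>mode_base Df DV \<gamma>.
    norm \<xi> \<in> A\<^sub>1 \<and> norm \<xi> \<in> A\<^sub>2 \<and>
    \<alpha>\<^sub>1 (norm \<xi>) \<le> V (\<xi>, \<gamma>) \<and> V (\<xi>, \<gamma>) \<le> \<alpha>\<^sub>2 (norm \<xi>))"

definition radially_unbounded ::
    "('a::euclidean_space \<times> 'g::metric_space) set \<Rightarrow> ('a \<times> 'g) set \<Rightarrow> ('a \<times> 'g \<Rightarrow> real) \<Rightarrow> bool"
  where "radially_unbounded Df DV V \<longleftrightarrow>
    (\<exists>\<alpha>\<^sub>1 \<alpha>\<^sub>2. class_K_inf \<alpha>\<^sub>1 \<and> class_K_inf \<alpha>\<^sub>2 \<and> sandwiched Df DV V {0..} \<alpha>\<^sub>1 {0..} \<alpha>\<^sub>2)"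

definition pre_Lyapunov_pair ::
    "('a::euclidean_space \<times> 'g::metric_space) set \<Rightarrow> ('a \<times> 'g \<Rightarrow> 'a) \<Rightarrow>
     ('a \<times> 'g) set \<Rightarrow> ('a \<times> 'g \<Rightarrow> real) \<Rightarrow> ('a \<times> 'g \<Rightarrow> real) \<Rightarrow> bool"
  where "pre_Lyapunov_pair Df f DV V W \<longleftrightarrow>
    class_V Df DV V \<and> 0 \<in> base DV \<and>
    (\<exists>A\<^sub>1 \<alpha>\<^sub>1 A\<^sub>2 \<alpha>\<^sub>2. class_K A\<^sub>1 \<alpha>\<^sub>1 \<and> class_K A\<^sub>2 \<alpha>\<^sub>2 \<and> sandwiched Df DV V A\<^sub>1 \<alpha>\<^sub>1 A\<^sub>2 \<alpha>\<^sub>2) \<and>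
    (\<forall>\<gamma>. \<forall>\<xi>\<in>mode_base Df DV \<gamma>.
      - frechet_derivative (\<lambda>\<zeta>. V (\<zeta>, \<gamma>)) (at \<xi>) (f (\<xi>, \<gamma>)) \<ge> W (\<xi>, \<gamma>) \<and> W (\<xi>, \<gamma>) \<ge> 0)"

definition weak_Lyapunov_pair ::
    "('a::euclidean_space \<times> 'g::metric_space) set \<Rightarrow> ('a \<times> 'g \<Rightarrow> 'a) \<Rightarrow> ('a, 'g) traj set \<Rightarrow>
     ('a \<times> 'g) set \<Rightarrow> ('a \<times> 'g \<Rightarrow> real) \<Rightarrow> ('a \<times> 'g \<Rightarrow> real) \<Rightarrow> bool"
  where "weak_Lyapunov_pair Df f \<T> DV V W \<longleftrightarrow>
    pre_Lyapunov_pair Df f DV V W \<and>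
    (\<forall>(I, x, \<sigma>)\<in>\<T>. \<forall>a b. 0 \<le> a \<and> (\<forall>t\<in>{a..b}. x t \<in> base DV) \<longrightarrow>
      antimono_on {a..b} (\<lambda>t. V (x t, \<sigma> t)))"

definition F_weak_Lyapunov_pair ::
    "('a::euclidean_space \<times> 'g::metric_space) set \<Rightarrow> ('a \<times> 'g \<Rightarrow> 'a) \<Rightarrow> ('a, 'g) traj set \<Rightarrow>
     ('a \<times> 'g) set \<Rightarrow> ('a \<times> 'g \<Rightarrow> real) \<Rightarrow> ('a \<times> 'g \<Rightarrow> real) \<Rightarrow> bool"
  where "F_weak_Lyapunov_pair Df f \<T> DV V W \<longleftrightarrow>
    pre_Lyapunov_pair Df f DV V W \<and>
    (\<forall>(I, x, \<sigma>)\<in>\<T>. \<forall>a b. 0 \<le> a \<and> (\<forall>t\<in>{a..b}. x t \<in> base DV) \<longrightarrow>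
      (\<forall>\<gamma>. antimono_on ({a..b} \<inter> \<sigma> -` {\<gamma>}) (\<lambda>t. V (x t, \<gamma>))))"

definition O_fwd_inf ::
    "('a::euclidean_space \<times> 'g) set \<Rightarrow> ('a \<times> 'g \<Rightarrow> 'a) \<Rightarrow> ('a \<times> 'g) set \<Rightarrow> ('a \<times> 'g \<Rightarrow> real) \<Rightarrow> 'g \<Rightarrow> 'a set"
  where "O_fwd_inf Df f DV W \<gamma> =
    obs_fwd_upto (mode_base Df DV \<gamma>) (\<lambda>\<xi>. f (\<xi>, \<gamma>)) (\<lambda>\<xi>. W (\<xi>, \<gamma>)) \<infinity>"

definition O_bwd_inf ::
    "('a::euclidean_space \<times> 'g) set \<Rightarrow> ('a \<times> 'g \<Rightarrow> 'a) \<Rightarrow> ('a \<times> 'g) set \<Rightarrow> ('a \<times> 'g \<Rightarrow> real) \<Rightarrow> 'g \<Rightarrow> 'a set"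
  where "O_bwd_inf Df f DV W \<gamma> =
    obs_bwd_upto (mode_base Df DV \<gamma>) (\<lambda>\<xi>. f (\<xi>, \<gamma>)) (\<lambda>\<xi>. W (\<xi>, \<gamma>)) \<infinity>"

definition O_fwd ::
    "('a::euclidean_space \<times> 'g) set \<Rightarrow> ('a \<times> 'g \<Rightarrow> 'a) \<Rightarrow> ('a \<times> 'g) set \<Rightarrow> ('a \<times> 'g \<Rightarrow> real) \<Rightarrow> 'g \<Rightarrow> 'a set"
  where "O_fwd Df f DV W \<gamma> =
    obs_fwd (mode_base Df DV \<gamma>) (\<lambda>\<xi>. f (\<xi>, \<gamma>)) (\<lambda>\<xi>. W (\<xi>, \<gamma>))"

definition O_bwd ::
    "('a::euclidean_space \<times> 'g) set \<Rightarrow> ('a \<times> 'g \<Rightarrow> 'a) \<Rightarrow> ('a \<times> 'g) set \<Rightarrow> ('a \<times> 'g \<Rightarrow> real) \<Rightarrow> 'g \<Rightarrow> 'a set"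
  where "O_bwd Df f DV W \<gamma> =
    obs_bwd (mode_base Df DV \<gamma>) (\<lambda>\<xi>. f (\<xi>, \<gamma>)) (\<lambda>\<xi>. W (\<xi>, \<gamma>))"

definition level_set :: "('a \<times> 'g) set \<Rightarrow> ('a \<times> 'g \<Rightarrow> real) \<Rightarrow> 'g \<Rightarrow> real \<Rightarrow> 'a set"
  where "level_set DV V \<gamma> c = {\<xi>\<in>slice DV \<gamma>. V (\<xi>, \<gamma>) = c}"

definition cond_i ::
    "('a::euclidean_space \<times> 'g) set \<Rightarrow> ('a \<times> 'g \<Rightarrow> 'a) \<Rightarrow> ('a \<times> 'g) set \<Rightarrow> ('a \<times> 'g \<Rightarrow> real) \<Rightarrow> bool"
  where "cond_i Df f DV W \<longleftrightarrow>
    (\<forall>\<gamma>. O_fwd_inf Df f DV W \<gamma> \<subseteq> {0}) \<or> (\<forall>\<gamma>. O_bwd_inf Df f DV W \<gamma> \<subseteq> {0})"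

definition cond_ii ::
    "('g \<Rightarrow> 'g set) \<Rightarrow> ('a::euclidean_space \<times> 'g) set \<Rightarrow> ('a \<times> 'g \<Rightarrow> 'a) \<Rightarrow>
     ('a \<times> 'g) set \<Rightarrow> ('a \<times> 'g \<Rightarrow> real) \<Rightarrow> bool"
  where "cond_ii H Df f DV W \<longleftrightarrow>
    (\<forall>m \<gamma>. simple_cycle H m \<gamma> \<longrightarrow> (\<exists>j\<in>{1..m-1}.
      O_bwd Df f DV W (\<gamma> j) \<inter> O_fwd Df f DV W (\<gamma> (j + 1)) \<subseteq> {0}))"

definition cond_iii ::
    "('g \<Rightarrow> 'g set) \<Rightarrow> ('a::euclidean_space \<times> 'g) set \<Rightarrow> ('a \<times> 'g \<Rightarrow> 'a) \<Rightarrow>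
     ('a \<times> 'g) set \<Rightarrow> ('a \<times> 'g \<Rightarrow> real) \<Rightarrow> ('a \<times> 'g \<Rightarrow> real) \<Rightarrow> bool"
  where "cond_iii H Df f DV V W \<longleftrightarrow>
    (\<forall>c. \<forall>m \<gamma>. simple_cycle H m \<gamma> \<longrightarrow> (\<exists>j\<in>{1..m-1}.
      O_bwd Df f DV W (\<gamma> j) \<inter> O_fwd Df f DV W (\<gamma> (j + 1)) \<inter>
      level_set DV V (\<gamma> j) c \<inter> level_set DV V (\<gamma> (j + 1)) c \<subseteq> {0}))"

end

theory Submission
  imports Defs "HOL-Complex_Analysis.Great_Picard"
begin

text \<open>
  A weak Lyapunov pair is in particular an F-weak one, so stability is proved for F-weak pairs only.
  From a state where a mode is active, the trajectory grows by at most the gain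
  \<open>\<alpha>\<^sub>1\<^sup>-\<^sup>1 \<circ> \<alpha>\<^sub>2\<close> (plus the identity) until any later time at which this mode is active again;
  since there are finitely many modes, a fixed iterate of this gain bounds the trajectory.

  Given stability, it suffices for attractivity that the trajectory comes arbitrarily close to \<open>0\<close>
  at arbitrarily late times.  Suppose it stays away from \<open>0\<close>.  Along the times at which mode \<open>\<gamma>\<close>
  is active, \<open>V\<^sub>\<gamma>\<close> converges, so every limit of late arcs in mode \<open>\<gamma>\<close> is a nonzero solution with
  constant \<open>V\<^sub>\<gamma>\<close>, hence with \<open>W\<^sub>\<gamma> = 0\<close>.  If there are finitely many jumps, such a limit exists on
  all of \<open>\<real>\<close>, against (i).  Otherwise the transitions that occur infinitely often contain a simple
  cycle of \<open>H\<close>; each of its transitions has, by the dwell time, a nonzero limit state preceded by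
  such a solution in the old mode and followed by one in the new mode, against (ii) or (iii).
\<close>

subsection \<open>Switching signals\<close>

text \<open>For an F-weak pair the value of V in the active mode may jump up at a switch, so
  monotonicity only compares times of equal mode; hence the gain iterated over the modes, and a
  separate limit level for each mode. The map f is merely continuous, so solutions in a mode need
  not be unique and there is no flow to pass to the limit with: limit solutions come from
  compactness. Trajectories satisfy the differential equation only almost everywhere, so arcs are
  rewritten as integral equations, which survive pointwise limits by dominated convergence;
  continuity of f then makes the limit curve differentiable at every time. This matters because W =
  0 is needed at every time of the limit arc, not just at almost every one. The dwell time may
  differ from signal to signal, since limits are only taken along a single trajectory; it gives each
  jump a window of fixed length on either side with one mode in it.\<close>

text \<open>A finite metric space is discrete, so convergence means eventual equality. This turns
  right continuity of a signal into local constancy to the right.\<close>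

lemma finite_type_tendsto_eventually_eq:
  fixes \<sigma> :: "'b \<Rightarrow> 'g::metric_space"
  assumes "finite (UNIV :: 'g set)" "(\<sigma> \<longlongrightarrow> l) F"
  shows "\<forall>\<^sub>F u in F. \<sigma> u = l"
proof -
  have "closed (UNIV - {l})"
    using assms(1) by (intro finite_imp_closed) auto
  then have "open {l}" by (simp add: closed_def Compl_eq_Diff_UNIV Diff_Diff_Int)
  with assms(2) show ?thesis using topological_tendstoD[of \<sigma> l F "{l}"] by auto
qed

lemma switching_signal_const_right:
  fixes \<sigma> :: "real \<Rightarrow> 'g::metric_space"
  assumes "finite (UNIV :: 'g set)" "switching_signal \<sigma>"
  obtains d where "d > 0" "\<And>u. t \<le> u \<Longrightarrow> u < t + d \<Longrightarrow> \<sigma> u = \<sigma> t"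
proof -
  have "(\<sigma> \<longlongrightarrow> \<sigma> t) (at_right t)"
    using assms(2) by (auto simp: switching_signal_def continuous_within)
  then have "\<forall>\<^sub>F u in at_right t. \<sigma> u = \<sigma> t"
    by (rule finite_type_tendsto_eventually_eq[OF assms(1)])
  then obtain b where b: "b > t" "\<And>u. t < u \<Longrightarrow> u < b \<Longrightarrow> \<sigma> u = \<sigma> t"
    by (auto simp: eventually_at_right_field)
  show thesis
    by (rule that[of "b - t"]) (use b in \<open>auto simp: less_eq_real_def\<close>)
qed

text \<open>The constancy clause of \<open>switching_signal\<close> is about closed intervals
  without jumps, but here a may itself be a jump time. Right continuity carries the value from a to
  some u > a, and the clause applies on [u, w].\<close>

lemma switching_signal_const_between:
  fixes \<sigma> :: "real \<Rightarrow> 'g::metric_space"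
  assumes "finite (UNIV :: 'g set)" "switching_signal \<sigma>"
    and "jump_times \<sigma> \<inter> {a<..<b} = {}" "a \<le> w" "w < b"
  shows "\<sigma> w = \<sigma> a"
proof (cases "w = a")
  case False
  obtain d where d: "d > 0" "\<And>u. a \<le> u \<Longrightarrow> u < a + d \<Longrightarrow> \<sigma> u = \<sigma> a"
    using switching_signal_const_right[OF assms(1,2), of a] by blast
  obtain u where u: "a < u" "u < min w (a + d)"
    using dense[of a "min w (a + d)"] d(1) False assms(4) by auto
  have "{u..w} \<subseteq> {a<..<b}" using u assms(5) by auto
  then have "jump_times \<sigma> \<inter> {u..w} = {}" using assms(3) by blast
  moreover have "u \<le> w" using u by simp
  ultimately have "\<sigma> u = \<sigma> w" using assms(2) unfolding switching_signal_def by blast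
  then show ?thesis using d(2)[of u] u by auto
qed simp

lemma switching_signal_left_limit:
  fixes \<sigma> :: "real \<Rightarrow> 'g::metric_space"
  assumes "finite (UNIV :: 'g set)" "switching_signal \<sigma>"
    and "jump_times \<sigma> \<inter> {a<..<b} = {}" "a < b"
  shows "(\<sigma> \<longlongrightarrow> \<sigma> a) (at_left b)" "Lim (at_left b) \<sigma> = \<sigma> a"
proof -
  have "\<forall>\<^sub>F w in at_left b. \<sigma> w = \<sigma> a"
    unfolding eventually_at_left_field
    using switching_signal_const_between[OF assms(1-3) less_imp_le] assms(4) by blast
  then show "(\<sigma> \<longlongrightarrow> \<sigma> a) (at_left b)" by (rule tendsto_eventually)
  then show "Lim (at_left b) \<sigma> = \<sigma> a" by (intro tendsto_Lim) auto
qed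

text \<open>Equal modes before and at t would make the signal continuous from both sides. This is
  what later excludes loops from a mode to itself, which are not simple cycles.\<close>

lemma switching_signal_jump_changes_mode:
  fixes \<sigma> :: "real \<Rightarrow> 'g::metric_space"
  assumes "finite (UNIV :: 'g set)" "switching_signal \<sigma>"
    and "jump_times \<sigma> \<inter> {a<..<t} = {}" "a < t" "t \<in> jump_times \<sigma>"
  shows "\<sigma> t \<noteq> \<sigma> a"
proof
  assume "\<sigma> t = \<sigma> a"
  then have "continuous (at_left t) \<sigma>"
    using switching_signal_left_limit(1)[OF assms(1-4)] by (simp add: continuous_within)
  moreover have "continuous (at_right t) \<sigma>"
    using assms(2) by (simp add: switching_signal_def)
  ultimately show False
    using assms(5) by (simp add: jump_times_def continuous_at_split)
qed

lemma switching_signal_next_jump: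
  assumes "switching_signal \<sigma>" "u \<in> jump_times \<sigma>" "t < u"
  obtains t' where "t < t'" "t' \<in> jump_times \<sigma>" "jump_times \<sigma> \<inter> {t<..<t'} = {}"
proof -
  define A where "A = jump_times \<sigma> \<inter> {t<..u}"
  have "finite (jump_times \<sigma> \<inter> {t..u})" using assms(1) by (simp add: switching_signal_def)
  then have "finite A" by (rule finite_subset[rotated]) (auto simp: A_def)
  moreover have "A \<noteq> {}" using assms(2,3) by (auto simp: A_def)
  ultimately have A: "finite A" "A \<noteq> {}" by auto
  have "Min A \<in> A" using A by simp
  moreover have "w \<notin> jump_times \<sigma>" if "t < w" "w < Min A" for w
  proof
    assume "w \<in> jump_times \<sigma>"
    then have "w \<in> A" using that \<open>Min A \<in> A\<close> by (auto simp: A_def)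
    then show False using Min_le[OF A(1), of w] that by simp
  qed
  ultimately show thesis by (intro that[of "Min A"]) (auto simp: A_def)
qed

section \<open>Simple cycles among recurrent transitions\<close>

text \<open>Every edge can be continued, so a walk along chosen successors goes on forever and must
  repeat a mode; the stretch up to the first repetition is a simple cycle. Irreflexivity supplies
  the length that \<open>3 \<le> m\<close> demands.\<close>

lemma simple_cycle_of_serial_relation:
  fixes E :: "'g \<Rightarrow> 'g \<Rightarrow> bool"
  assumes fin: "finite (UNIV :: 'g set)"
    and E: "\<And>\<gamma>. \<not> E \<gamma> \<gamma>" "\<And>\<gamma> \<gamma>'. E \<gamma> \<gamma>' \<Longrightarrow> \<gamma>' \<in> H \<gamma>" "\<And>\<gamma> \<gamma>'. E \<gamma> \<gamma>' \<Longrightarrow> \<exists>\<gamma>''. E \<gamma>' \<gamma>''"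
    and start: "E \<gamma>\<^sub>0 \<gamma>\<^sub>1"
  obtains m \<gamma> where "simple_cycle H m \<gamma>" "\<And>j. j \<in> {1..m-1} \<Longrightarrow> E (\<gamma> j) (\<gamma> (j + 1))"
proof -
  define nxt where "nxt \<gamma> = (SOME \<gamma>'. E \<gamma> \<gamma>')" for \<gamma>
  define g where "g n = (nxt ^^ n) \<gamma>\<^sub>1" for n
  have nxt: "E \<gamma>' (nxt \<gamma>')" if "E \<gamma> \<gamma>'" for \<gamma> \<gamma>'
    unfolding nxt_def by (rule someI_ex) (use E(3) that in blast)
  have "\<exists>\<gamma>. E \<gamma> (g n)" for n
    by (induction n) (use start nxt in \<open>auto simp: g_def\<close>)
  then have step: "E (g n) (g (Suc n))" for n
    using nxt by (fastforce simp: g_def)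
  have "\<not> inj g"
    using fin finite_imageD[of g UNIV] by (metis finite_subset infinite_UNIV_nat subset_UNIV)
  then have ex: "\<exists>j. \<exists>i<j. g i = g j"
    unfolding inj_def by (metis linorder_neqE_nat)
  \<comment> \<open>Minimality of j makes g injective below j, so \<open>g i = g j\<close> is the
    only coincidence between i and j.\<close>
  define j where "j = (LEAST j. \<exists>i<j. g i = g j)"
  obtain i where i: "i < j" "g i = g j"
    using LeastI_ex[OF ex] unfolding j_def by blast
  have min: "\<not> (k < l \<and> g k = g l)" if "l < j" for k l
    using not_less_Least[of l "\<lambda>j. \<exists>i<j. g i = g j"] that by (auto simp: j_def)
  have "j \<noteq> Suc i" using step[of i] E(1) i(2) by metis
  with i have ij: "i + 2 \<le> j" by simp
  \<comment> \<open>The cycle lists g i, ..., g j with its first and last entries equal, renumbered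
    to start at 1.\<close>
  define m where "m = j - i + 1"
  define \<gamma> where "\<gamma> l = g (i + l - 1)" for l
  have edge: "E (\<gamma> l) (\<gamma> (l + 1))" if "l \<in> {1..m-1}" for l
    using step[of "i + l - 1"] that by (simp add: \<gamma>_def)
  have "simple_cycle H m \<gamma>"
    unfolding simple_cycle_def
  proof (intro conjI ballI impI)
    show "3 \<le> m" using ij by (simp add: m_def)
    show "\<gamma> 1 = \<gamma> m" using i by (simp add: m_def \<gamma>_def)
    show "\<gamma> (l + 1) \<in> H (\<gamma> l)" if "l \<in> {1..m-1}" for l using edge[OF that] E(2) by blast
    fix a b assume ab: "a \<in> {1..m}" "b \<in> {1..m}" "\<gamma> a = \<gamma> b \<and> a < b"
    \<comment> \<open>A coincidence whose right end lies before j contradicts minimality, so the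
      right end is j. Its left end then repeats g i, and minimality again leaves only a = 1.\<close>
    have "\<not> i + b - 1 < j"
      using min[of "i + b - 1" "i + a - 1"] ab by (auto simp: \<gamma>_def)
    then show bm: "b = m" using ab i(1) by (auto simp: m_def)
    have "g (i + a - 1) = g i" using ab bm i by (simp add: \<gamma>_def m_def)
    moreover have "i + a - 1 < j" using ab bm i(1) by (auto simp: m_def)
    ultimately have "\<not> i < i + a - 1" using min[of "i + a - 1" i] by auto
    then show "a = 1" using ab by auto
  qed
  with edge show thesis using that by blast
qed

text \<open>The left limit is written as in \<open>signals_H\<close>, so that an edge of this
  relation is an edge of H. Recurrence at arbitrarily late times is what allows a limit to be
  extracted at every single edge of a cycle.\<close>

definition recurrent_transition :: "(real \<Rightarrow> 'g::metric_space) \<Rightarrow> 'g \<Rightarrow> 'g \<Rightarrow> bool"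
  where "recurrent_transition \<sigma> \<gamma> \<gamma>' \<longleftrightarrow>
    (\<exists>\<^sub>F t in at_top. t \<in> jump_times \<sigma> \<and> Lim (at_left t) \<sigma> = \<gamma> \<and> \<sigma> t = \<gamma>')"

lemma frequently_at_top_real: "(\<exists>\<^sub>F t in at_top. P t) \<longleftrightarrow> (\<forall>u::real. \<exists>t\<ge>u. P t)"
  by (auto simp: frequently_def eventually_at_top_linorder)

text \<open>The mode before a jump t can be read off at t - \<tau> even if t - \<tau> is itself a
  jump, because signals are continuous from the right.\<close>

lemma signals_d_gap:
  fixes \<sigma> :: "real \<Rightarrow> 'g::metric_space"
  assumes "finite (UNIV :: 'g set)" "\<sigma> \<in> signals_d"
  obtains \<tau> where "0 < \<tau>"
    "\<And>t. t \<in> jump_times \<sigma> \<Longrightarrow> jump_times \<sigma> \<inter> {t - \<tau><..<t} = {}"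
    "\<And>t. t \<in> jump_times \<sigma> \<Longrightarrow> jump_times \<sigma> \<inter> {t<..<t + \<tau>} = {}"
    "\<And>t. t \<in> jump_times \<sigma> \<Longrightarrow> Lim (at_left t) \<sigma> = \<sigma> (t - \<tau>)"
proof -
  obtain \<tau> where \<tau>: "0 < \<tau>"
    and dwell: "\<And>t t'. t \<in> jump_times \<sigma> \<Longrightarrow> t' \<in> jump_times \<sigma> \<Longrightarrow> t \<noteq> t' \<Longrightarrow> \<tau> \<le> \<bar>t - t'\<bar>"
    using assms(2) by (auto simp: signals_d_def signals_dwell_def)
  have gap: "jump_times \<sigma> \<inter> {t - \<tau><..<t} = {}" "jump_times \<sigma> \<inter> {t<..<t + \<tau>} = {}"
    if "t \<in> jump_times \<sigma>" for t
    using dwell[OF that] by force+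
  have sw: "switching_signal \<sigma>" using assms(2) by (auto simp: signals_d_def signals_dwell_def)
  have left: "Lim (at_left t) \<sigma> = \<sigma> (t - \<tau>)" if "t \<in> jump_times \<sigma>" for t
    using switching_signal_left_limit(2)[OF assms(1) sw gap(1)[OF that]] \<tau> by simp
  show thesis by (rule that[OF \<tau> gap left])
qed

text \<open>Two uses of the pigeonhole principle. Infinitely many jumps share finitely many pairs of
  modes, so some transition recurs. If a transition into \<gamma>' recurs, then so do the jumps that
  follow it, all of which leave \<gamma>', and one of their targets recurs.\<close>

lemma recurrent_transitions_contain_cycle:
  fixes \<sigma> :: "real \<Rightarrow> 'g::metric_space"
  assumes fin: "finite (UNIV :: 'g set)" and \<sigma>: "\<sigma> \<in> signals_d" "\<sigma> \<in> signals_H H"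
    and jumps: "\<exists>\<^sub>F t in at_top. t \<in> jump_times \<sigma>"
  obtains m \<gamma> where "simple_cycle H m \<gamma>"
    "\<And>j. j \<in> {1..m-1} \<Longrightarrow> recurrent_transition \<sigma> (\<gamma> j) (\<gamma> (j + 1))"
proof -
  let ?E = "recurrent_transition \<sigma>"
  have sw: "switching_signal \<sigma>" using \<sigma>(2) by (simp add: signals_H_def)
  obtain \<tau> where \<tau>: "0 < \<tau>"
    and gap: "\<And>t. t \<in> jump_times \<sigma> \<Longrightarrow> jump_times \<sigma> \<inter> {t - \<tau><..<t} = {}"
    and left: "\<And>t. t \<in> jump_times \<sigma> \<Longrightarrow> Lim (at_left t) \<sigma> = \<sigma> (t - \<tau>)"
    using signals_d_gap[OF fin \<sigma>(1)] by metis
  have E_at: "\<exists>t\<ge>u. t \<in> jump_times \<sigma> \<and> Lim (at_left t) \<sigma> = \<gamma> \<and> \<sigma> t = \<gamma>'" if "?E \<gamma> \<gamma>'" for \<gamma> \<gamma>' u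
    using that by (auto simp: recurrent_transition_def frequently_at_top_real)
  have "\<exists>\<^sub>F t in at_top. \<exists>p\<in>(UNIV :: ('g \<times> 'g) set). t \<in> jump_times \<sigma> \<and> Lim (at_left t) \<sigma> = fst p \<and> \<sigma> t = snd p"
    using jumps by simp
  from frequently_bex_finite[OF finite_Prod_UNIV[OF fin fin] this]
  obtain \<gamma>\<^sub>0 \<gamma>\<^sub>1 where start: "?E \<gamma>\<^sub>0 \<gamma>\<^sub>1" unfolding recurrent_transition_def by blast
  have irrefl: "\<not> ?E \<gamma> \<gamma>" for \<gamma>
  proof
    assume "?E \<gamma> \<gamma>"
    then obtain t where t: "t \<in> jump_times \<sigma>" "Lim (at_left t) \<sigma> = \<gamma>" "\<sigma> t = \<gamma>" using E_at by blast
    then show False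
      using switching_signal_jump_changes_mode[OF fin sw gap[OF t(1)] _ t(1)] left[OF t(1)] \<tau> by auto
  qed
  have EH: "\<gamma>' \<in> H \<gamma>" if "?E \<gamma> \<gamma>'" for \<gamma> \<gamma>'
    using E_at[OF that] \<sigma>(2) by (auto simp: signals_H_def)
  have succ: "\<exists>\<gamma>''. ?E \<gamma>' \<gamma>''" if Eg: "?E \<gamma> \<gamma>'" for \<gamma> \<gamma>'
  proof -
    have "\<exists>\<^sub>F t in at_top. \<exists>\<gamma>''\<in>UNIV. t \<in> jump_times \<sigma> \<and> Lim (at_left t) \<sigma> = \<gamma>' \<and> \<sigma> t = \<gamma>''"
      unfolding frequently_at_top_real
    proof
      fix u
      obtain t where t: "u \<le> t" "t \<in> jump_times \<sigma>" "\<sigma> t = \<gamma>'" using E_at[OF Eg] by blast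
      \<comment> \<open>The jump w only shows that t is not the last jump; t' is the first one after
        t, so \<gamma>' is still active just before t'.\<close>
      obtain w where w: "t + 1 \<le> w" "w \<in> jump_times \<sigma>" using jumps by (auto simp: frequently_at_top_real)
      obtain t' where t': "t < t'" "t' \<in> jump_times \<sigma>" "jump_times \<sigma> \<inter> {t<..<t'} = {}"
        using switching_signal_next_jump[OF sw w(2), of t] w(1) by force
      have "Lim (at_left t') \<sigma> = \<gamma>'"
        using switching_signal_left_limit(2)[OF fin sw t'(3,1)] t by simp
      then show "\<exists>t\<ge>u. \<exists>\<gamma>''\<in>UNIV. t \<in> jump_times \<sigma> \<and> Lim (at_left t) \<sigma> = \<gamma>' \<and> \<sigma> t = \<gamma>''"
        using t t' by (intro exI[of _ t']) auto
    qed
    from frequently_bex_finite[OF fin this] show ?thesis unfolding recurrent_transition_def by blast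
  qed
  show thesis
    by (rule simple_cycle_of_serial_relation[of ?E H \<gamma>\<^sub>0 \<gamma>\<^sub>1]) (use fin irrefl EH succ start that in blast)+
qed

subsection \<open>Comparison functions and stability\<close>

lemma abs_cont_on_interval_imp_continuous_on:
  assumes "abs_cont_on_interval a b x"
  shows "continuous_on {a..b} x"
  unfolding continuous_on_iff
proof clarify
  fix t and e :: real assume t: "t \<in> {a..b}" and "0 < e"
  have "\<exists>\<delta>>0. \<forall>P :: (real \<times> real) set.
      finite P \<and> (\<forall>(s, t)\<in>P. a \<le> s \<and> s < t \<and> t \<le> b) \<and>
      (\<forall>(s, t)\<in>P. \<forall>(s', t')\<in>P. (s, t) \<noteq> (s', t') \<longrightarrow> {s<..<t} \<inter> {s'<..<t'} = {}) \<and>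
      (\<Sum>(s, t)\<in>P. t - s) < \<delta>
      \<longrightarrow> (\<Sum>(s, t)\<in>P. norm (x t - x s)) < e"
    by (rule assms[unfolded abs_cont_on_interval_def, rule_format]) (rule \<open>0 < e\<close>)
  then obtain \<delta> where \<delta>: "\<delta> > 0" and P: "\<And>P :: (real \<times> real) set.
      finite P \<and> (\<forall>(s, t)\<in>P. a \<le> s \<and> s < t \<and> t \<le> b) \<and>
      (\<forall>(s, t)\<in>P. \<forall>(s', t')\<in>P. (s, t) \<noteq> (s', t') \<longrightarrow> {s<..<t} \<inter> {s'<..<t'} = {}) \<and>
      (\<Sum>(s, t)\<in>P. t - s) < \<delta> \<Longrightarrow> (\<Sum>(s, t)\<in>P. norm (x t - x s)) < e"
    by (elim exE conjE) (rule that, assumption, blast)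
  have *: "norm (x v - x u) < e" if "a \<le> u" "u < v" "v \<le> b" "v - u < \<delta>" for u v
    using P[of "{(u, v)}"] that by simp
  have "dist (x s) (x t) < e" if "s \<in> {a..b}" "dist s t < \<delta>" for s
  proof (cases s t rule: linorder_cases)
    case less
    then show ?thesis using *[of s t] that t by (auto simp: dist_norm norm_minus_commute)
  next
    case equal
    then show ?thesis using \<open>0 < e\<close> by simp
  next
    case greater
    then show ?thesis using *[of t s] that t by (auto simp: dist_norm norm_minus_commute)
  qed
  then show "\<exists>d>0. \<forall>s\<in>{a..b}. dist s t < d \<longrightarrow> dist (x s) (x t) < e"
    using \<delta> by blast
qed

lemma trajectory_continuous_on:
  assumes "trajectory Df f (I, x, \<sigma>)" "forward_complete (I, x, \<sigma>)" "0 \<le> a"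
  shows "continuous_on {a..b} x"
proof (rule abs_cont_on_interval_imp_continuous_on)
  have "{a..b} \<subseteq> I" using assms(2,3) by (force simp: forward_complete_def)
  then show "abs_cont_on_interval a b x"
    using assms(1) by (simp add: trajectory_def has_ae_derivative_on_def locally_abs_cont_on_def)
qed

section \<open>Comparison functions, gains and their iterates\<close>

lemma class_K_infI:
  assumes "class_K {0..} \<beta>" "\<And>s. 0 \<le> s \<Longrightarrow> s - c \<le> \<beta> s"
  shows "class_K_inf \<beta>"
  unfolding class_K_inf_def
proof (intro conjI notI assms(1))
  assume "bounded (\<beta> ` {0..})"
  then obtain B where B: "\<And>s. 0 \<le> s \<Longrightarrow> \<bar>\<beta> s\<bar> \<le> B" by (auto simp: bounded_iff)
  show False using B[of "\<bar>B\<bar> + \<bar>c\<bar> + 1"] assms(2)[of "\<bar>B\<bar> + \<bar>c\<bar> + 1"] by linarith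
qed

lemma class_K_infD:
  assumes "class_K_inf \<beta>"
  shows "\<beta> 0 = 0" "continuous_on {0..} \<beta>" "0 \<le> s \<Longrightarrow> s < t \<Longrightarrow> \<beta> s < \<beta> t"
    "0 \<le> s \<Longrightarrow> s \<le> t \<Longrightarrow> \<beta> s \<le> \<beta> t" "0 \<le> s \<Longrightarrow> 0 \<le> \<beta> s"
proof -
  show 1: "\<beta> 0 = 0" "continuous_on {0..} \<beta>"
    using assms by (auto simp: class_K_inf_def class_K_def)
  show 2: "\<beta> s < \<beta> t" if "0 \<le> s" "s < t" for s t
    using assms that by (auto simp: class_K_inf_def class_K_def strict_mono_on_def)
  show 3: "\<beta> s \<le> \<beta> t" if "0 \<le> s" "s \<le> t" for s t
    using 2[of s t] that by (cases "s = t") auto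
  show "0 \<le> s \<Longrightarrow> 0 \<le> \<beta> s" using 1 3[of 0 s] by auto
qed

lemma class_K_inf_restrict:
  assumes "class_K_inf \<beta>" "0 < r"
  shows "class_K {0..r} \<beta>"
  using class_K_infD[OF assms(1)] assms(2)
  by (auto simp: class_K_def strict_mono_on_def intro: continuous_on_subset)

lemma class_K_inf_small:
  assumes "class_K_inf \<beta>" "0 < e"
  obtains d where "0 < d" "\<And>s. 0 \<le> s \<Longrightarrow> s \<le> d \<Longrightarrow> \<beta> s < e"
proof -
  obtain d where "d > 0" "\<And>s. s \<in> {0..} \<Longrightarrow> dist s 0 < d \<Longrightarrow> dist (\<beta> s) (\<beta> 0) < e"
    using class_K_infD(2)[OF assms(1)] assms(2) unfolding continuous_on_iff
    by (metis atLeast_iff order_refl)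
  then have "\<beta> s < e" if "0 \<le> s" "s \<le> d / 2" for s
    using that class_K_infD(1)[OF assms(1)] by (force simp: dist_real_def)
  with \<open>d > 0\<close> show thesis using that[of "d / 2"] by auto
qed

text \<open>Beyond r the function is continued with slope one, which keeps it continuous and
  strictly increasing and makes it unbounded. Local estimates only see small arguments, so they may
  use the extension, whose inverse is defined on all of [0, \<infinity>).\<close>

lemma class_K_extend:
  assumes "class_K A \<alpha>"
  obtains \<beta> r where "0 < r" "{0..r} \<subseteq> A" "class_K_inf \<beta>" "\<And>s. s \<in> {0..r} \<Longrightarrow> \<beta> s = \<alpha> s"
proof -
  obtain r where r: "r > 0" "{0..r} \<subseteq> A"
    using assms unfolding class_K_def by (metis Icc_subset_Ici_iff order_refl zero_less_one)
  have mono: "\<alpha> s < \<alpha> t" if "0 \<le> s" "s < t" "t \<le> r" for s t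
    using assms that r by (auto simp: class_K_def strict_mono_on_def subset_eq)
  have c: "continuous_on {0..r} \<alpha>"
    using assms r by (auto simp: class_K_def intro: continuous_on_subset)
  have a0: "\<alpha> 0 = 0" using assms by (simp add: class_K_def)
  define \<beta> where "\<beta> s = \<alpha> (min s r) + (s - min s r)" for s
  have "strict_mono_on {0..} \<beta>"
  proof (rule strict_mono_onI)
    fix s t :: real assume st: "s \<in> {0..}" "t \<in> {0..}" "s < t"
    show "\<beta> s < \<beta> t"
    proof (cases "s < r")
      case True
      then have "\<alpha> s < \<alpha> (min t r)" using mono[of s "min t r"] st by auto
      then show ?thesis using True by (auto simp: \<beta>_def)
    next
      case False
      then show ?thesis using st by (auto simp: \<beta>_def)
    qed
  qed
  moreover have "continuous_on {0..} \<beta>"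
    unfolding \<beta>_def using r
    by (intro continuous_intros continuous_on_compose2[OF c]) auto
  moreover have "\<beta> 0 = 0" using r a0 by (simp add: \<beta>_def)
  ultimately have "class_K {0..} \<beta>" by (simp add: class_K_def)
  moreover have "s - r \<le> \<beta> s" if "0 \<le> s" for s
  proof -
    have "0 \<le> min s r" "min s r \<le> r" using that r by auto
    then have "0 \<le> \<alpha> (min s r)" using mono[of 0 "min s r"] a0
      by (cases "min s r = 0") (simp, metis less_eq_real_def)
    then show ?thesis by (auto simp: \<beta>_def)
  qed
  ultimately have "class_K_inf \<beta>" by (rule class_K_infI)
  moreover have "\<beta> s = \<alpha> s" if "s \<in> {0..r}" for s using that by (auto simp: \<beta>_def)
  ultimately show thesis using that r by blast
qed

text \<open>The gain is \<open>\<alpha>\<^sub>1\<close> inverted after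
  \<open>\<alpha>\<^sub>2\<close>, with the identity added so that s \<le> \<beta> s holds without
  any comparison of \<open>\<alpha>\<^sub>1\<close> with \<open>\<alpha>\<^sub>2\<close>; iterating
  \<beta> then never lowers a bound.\<close>

lemma class_K_inf_gain:
  assumes \<alpha>: "class_K_inf \<alpha>\<^sub>1" "class_K_inf \<alpha>\<^sub>2"
  obtains \<beta> where "class_K_inf \<beta>" "\<And>s. 0 \<le> s \<Longrightarrow> s \<le> \<beta> s"
    "\<And>p s. 0 \<le> p \<Longrightarrow> 0 \<le> s \<Longrightarrow> \<alpha>\<^sub>1 p \<le> \<alpha>\<^sub>2 s \<Longrightarrow> p \<le> \<beta> s"
proof -
  note K1 = class_K_infD[OF \<alpha>(1)] and K2 = class_K_infD[OF \<alpha>(2)]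
  have surj: "\<exists>s\<ge>0. \<alpha>\<^sub>1 s = y" if "0 \<le> y" for y
  proof -
    have "\<not> (\<forall>s\<ge>0. \<bar>\<alpha>\<^sub>1 s\<bar> \<le> y)"
      using \<alpha>(1) by (auto simp: class_K_inf_def bounded_iff)
    then obtain b where b: "0 \<le> b" "y \<le> \<alpha>\<^sub>1 b" using K1(5) by force
    moreover have "continuous_on {0..b} \<alpha>\<^sub>1" using K1(2) by (rule continuous_on_subset) auto
    ultimately show ?thesis using IVT'[of \<alpha>\<^sub>1 0 y b] K1(1) that by auto
  qed
  define g where "g y = (SOME s. 0 \<le> s \<and> \<alpha>\<^sub>1 s = y)" for y
  have g: "0 \<le> g y \<and> \<alpha>\<^sub>1 (g y) = y" if "0 \<le> y" for y
    unfolding g_def by (rule someI_ex) (use surj[OF that] in blast)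
  have le: "p \<le> g y" if "0 \<le> p" "0 \<le> y" "\<alpha>\<^sub>1 p \<le> y" for p y
    using g[of y] K1(3)[of "g y" p] that by force
  have gmono: "g y < g z" if "0 \<le> y" "y < z" for y z
    using g[of y] g[of z] K1(4)[of "g z" "g y"] that by force
  have ginv: "g (\<alpha>\<^sub>1 s) = s" if "0 \<le> s" for s
    using g[of "\<alpha>\<^sub>1 s"] K1(3)[of s "g (\<alpha>\<^sub>1 s)"] K1(3)[of "g (\<alpha>\<^sub>1 s)" s] K1(5)[OF that] that
    by (cases s "g (\<alpha>\<^sub>1 s)" rule: linorder_cases) auto
  have cont: "continuous_on {0..} g"
    unfolding continuous_on_eq_continuous_within
  proof
    fix y :: real assume "y \<in> {0..}"
    then have y: "0 \<le> y" by simp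
    \<comment> \<open>Inverses are continuous on images of compact sets. The choice of b beyond g y
      puts y strictly below the end of the image [0, \<open>\<alpha>\<^sub>1 b\<close>], so
      continuity there is continuity within [0, \<infinity>).\<close>
    define b where "b = g y + 1"
    have b: "0 \<le> b" "y < \<alpha>\<^sub>1 b" using g[OF y] K1(3)[of "g y" b] by (auto simp: b_def)
    have img: "\<alpha>\<^sub>1 ` {0..b} = {0..\<alpha>\<^sub>1 b}"
    proof
      show "\<alpha>\<^sub>1 ` {0..b} \<subseteq> {0..\<alpha>\<^sub>1 b}" using K1(4,5) by auto
      show "{0..\<alpha>\<^sub>1 b} \<subseteq> \<alpha>\<^sub>1 ` {0..b}"
      proof
        fix z assume z: "z \<in> {0..\<alpha>\<^sub>1 b}"
        then have "g z \<in> {0..b}" using g[of z] K1(3)[of b "g z"] b by force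
        then show "z \<in> \<alpha>\<^sub>1 ` {0..b}" using g[of z] z by force
      qed
    qed
    have "continuous_on (\<alpha>\<^sub>1 ` {0..b}) g"
      by (rule continuous_on_inv) (use K1(2) ginv in \<open>auto intro: continuous_on_subset\<close>)
    then have "continuous (at y within {0..\<alpha>\<^sub>1 b}) g"
      unfolding img using y b by (auto simp: continuous_on_eq_continuous_within)
    moreover have "at y within {0..} = at y within {0..\<alpha>\<^sub>1 b}"
      by (rule at_within_nhd[of _ "{..<\<alpha>\<^sub>1 b}"]) (use b in auto)
    ultimately show "continuous (at y within {0..}) g" by (simp add: continuous_within)
  qed
  define \<beta> where "\<beta> s = g (\<alpha>\<^sub>2 s) + s" for s
  have "strict_mono_on {0..} \<beta>"
    using gmono K2 by (auto simp: \<beta>_def strict_mono_on_def intro!: add_strict_mono)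
  moreover have "continuous_on {0..} \<beta>"
    unfolding \<beta>_def using K2
    by (intro continuous_intros continuous_on_compose2[OF cont]) auto
  moreover have "\<beta> 0 = 0" using ginv[of 0] K1(1) K2(1) by (simp add: \<beta>_def)
  ultimately have K: "class_K {0..} \<beta>" by (simp add: class_K_def)
  have ge: "s \<le> \<beta> s" if "0 \<le> s" for s using g[of "\<alpha>\<^sub>2 s"] K2(5)[OF that] by (simp add: \<beta>_def)
  have "class_K_inf \<beta>" by (rule class_K_infI[OF K, of 0]) (use ge in simp)
  moreover have "p \<le> \<beta> s" if "0 \<le> p" "0 \<le> s" "\<alpha>\<^sub>1 p \<le> \<alpha>\<^sub>2 s" for p s
    using le[of p "\<alpha>\<^sub>2 s"] that K2(5)[of s] by (simp add: \<beta>_def)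
  ultimately show thesis using that ge by blast
qed

text \<open>The lower bound by the identity is carried through the induction because it yields
  unboundedness of the iterate.\<close>

lemma class_K_inf_funpow:
  assumes "class_K_inf \<beta>" "\<And>s. 0 \<le> s \<Longrightarrow> s \<le> \<beta> s"
  shows "class_K_inf (\<beta> ^^ n)" "\<And>s. 0 \<le> s \<Longrightarrow> s \<le> (\<beta> ^^ n) s"
proof (induction n)
  case 0
  {
    case 1
    show ?case by (rule class_K_infI[of _ 0]) (auto simp: class_K_def strict_mono_on_def)
  next
    case 2
    then show ?case by simp
  }
next
  case (Suc n)
  note K = class_K_infD[OF assms(1)] and Kn = class_K_infD[OF Suc(1)]
  have ge: "s \<le> (\<beta> ^^ Suc n) s" if "0 \<le> s" for s
    using Suc(2)[OF that] assms(2)[of "(\<beta> ^^ n) s"] that by simp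
  {
    case 1
    have "continuous_on {0..} (\<lambda>s. \<beta> ((\<beta> ^^ n) s))"
      using K Kn by (intro continuous_on_compose2[OF K(2) Kn(2)]) auto
    moreover have "strict_mono_on {0..} (\<beta> ^^ Suc n)"
      using K Kn by (auto simp: strict_mono_on_def)
    ultimately show ?case
      using ge K(1) Kn(1) by (intro class_K_infI[of _ 0]) (auto simp: class_K_def comp_def)
  next
    case 2
    then show ?case by (rule ge)
  }
qed

text \<open>Induction on the number of modes visited so far: a mode is entered for the first time at a
  state that is bounded because fewer modes had been visited before.\<close>

lemma modes_visited_bound:
  fixes x :: "real \<Rightarrow> 'a::real_normed_vector" and \<sigma> :: "real \<Rightarrow> 'g::metric_space"
  assumes fin: "finite (UNIV :: 'g set)" and sw: "switching_signal \<sigma>"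
    and cont: "continuous_on {t\<^sub>0..t\<^sub>1} x"
    and \<beta>: "class_K_inf \<beta>" "\<And>s. 0 \<le> s \<Longrightarrow> s \<le> \<beta> s"
    and step: "\<And>s t. t\<^sub>0 \<le> s \<Longrightarrow> s \<le> t \<Longrightarrow> t \<le> t\<^sub>1 \<Longrightarrow> \<sigma> s = \<sigma> t \<Longrightarrow> norm (x t) \<le> \<beta> (norm (x s))"
    and t: "t\<^sub>0 \<le> t" "t \<le> t\<^sub>1"
  shows "norm (x t) \<le> (\<beta> ^^ CARD('g)) (norm (x t\<^sub>0))"
proof -
  note K = class_K_infD[OF \<beta>(1)]
  have fins: "finite A" for A :: "'g set" using fin by (rule finite_subset[rotated]) auto
  have "norm (x t) \<le> (\<beta> ^^ k) (norm (x t\<^sub>0))"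
    if "card (\<sigma> ` {t\<^sub>0..t}) \<le> k" "t\<^sub>0 \<le> t" "t \<le> t\<^sub>1" for k t
    using that
  proof (induction k arbitrary: t)
    case 0
    then have "\<sigma> ` {t\<^sub>0..t} = {}" using fins by (metis card_eq_0_iff le_zero_eq)
    then show ?case using 0 by auto
  next
    case (Suc k)
    define S where "S = {u \<in> {t\<^sub>0..t}. \<sigma> u = \<sigma> t}"
    define s where "s = Inf S"
    have tS: "t \<in> S" using Suc by (auto simp: S_def)
    have bdd: "bdd_below S" by (rule bdd_belowI[of _ t\<^sub>0]) (auto simp: S_def)
    have st: "t\<^sub>0 \<le> s" "s \<le> t"
      unfolding s_def using tS bdd by (auto intro!: cInf_greatest cInf_lower simp: S_def)
    have before: "\<sigma> u \<noteq> \<sigma> t" if "t\<^sub>0 \<le> u" "u < s" for u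
      using cInf_lower[OF _ bdd, of u] that st by (auto simp: S_def s_def)
    \<comment> \<open>Constancy to the right of s makes the infimum itself a time at which the final
      mode is active.\<close>
    have ss: "\<sigma> s = \<sigma> t"
    proof -
      obtain d where d: "d > 0" "\<And>u. s \<le> u \<Longrightarrow> u < s + d \<Longrightarrow> \<sigma> u = \<sigma> s"
        using switching_signal_const_right[OF fin sw, of s] by blast
      then obtain u where u: "u \<in> S" "u < s + d"
        using cInf_lessD[of S "s + d"] tS by (auto simp: s_def)
      have "s \<le> u" using cInf_lower[OF u(1) bdd] by (simp add: s_def)
      then show ?thesis using d(2)[of u] u by (auto simp: S_def)
    qed
    have xs: "norm (x s) \<le> (\<beta> ^^ k) (norm (x t\<^sub>0))"
    proof (cases "s = t\<^sub>0")
      case True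
      then show ?thesis using class_K_inf_funpow(2)[OF \<beta>] by simp
    next
      case False
      with st have s: "t\<^sub>0 < s" by simp
      \<comment> \<open>On [\<open>t\<^sub>0\<close>, u] the mode \<sigma> t has not occurred yet,
        so the induction hypothesis applies. It need not apply at s, where that mode enters;
        continuity of x carries the bound over.\<close>
      have le: "norm (x u) \<le> (\<beta> ^^ k) (norm (x t\<^sub>0))" if u: "t\<^sub>0 \<le> u" "u < s" for u
      proof (rule Suc.IH)
        have "\<sigma> ` {t\<^sub>0..u} \<subseteq> \<sigma> ` {t\<^sub>0..t} - {\<sigma> t}" using before u st by force
        then have "card (\<sigma> ` {t\<^sub>0..u}) \<le> card (\<sigma> ` {t\<^sub>0..t} - {\<sigma> t})" by (rule card_mono[OF fins])
        also have "\<dots> = card (\<sigma> ` {t\<^sub>0..t}) - 1" using Suc.prems by (intro card_Diff_singleton) auto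
        finally show "card (\<sigma> ` {t\<^sub>0..u}) \<le> k" using Suc.prems(1) by simp
      qed (use u st Suc.prems in auto)
      have "continuous (at s within {t\<^sub>0..t\<^sub>1}) x"
        using cont st Suc.prems by (auto simp: continuous_on_eq_continuous_within)
      then have "(x \<longlongrightarrow> x s) (at s within {t\<^sub>0<..<s})"
        unfolding continuous_within by (rule tendsto_within_subset) (use st Suc.prems in auto)
      then have "((\<lambda>u. norm (x u)) \<longlongrightarrow> norm (x s)) (at s within {t\<^sub>0<..<s})"
        by (rule tendsto_norm)
      then show ?thesis
      proof (rule tendsto_upperbound)
        show "\<forall>\<^sub>F u in at s within {t\<^sub>0<..<s}. norm (x u) \<le> (\<beta> ^^ k) (norm (x t\<^sub>0))"
          using le by (auto simp: eventually_at_filter)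
        have "at s within {t\<^sub>0<..<s} = at_left s"
          by (rule at_within_nhd[of _ "{t\<^sub>0<..}"]) (use s in auto)
        then show "at s within {t\<^sub>0<..<s} \<noteq> bot" by simp
      qed
    qed
    have "norm (x t) \<le> \<beta> (norm (x s))" by (rule step) (use st ss Suc.prems in auto)
    also have "\<dots> \<le> \<beta> ((\<beta> ^^ k) (norm (x t\<^sub>0)))" using xs K(4) by simp
    finally show ?case by simp
  qed
  then show ?thesis using t card_mono[OF fin, of "\<sigma> ` {t\<^sub>0..t}"] by auto
qed

section \<open>Uniform bounds for trajectories of an F-weak pair\<close>

text \<open>Between two times of equal mode V does not increase, and the sandwich inequality at both
  ends turns this into one application of \<beta>. The region B, where that inequality is available,
  is a small ball in the local case and the whole space in the global one.\<close>

lemma F_weak_gain_bound: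
  fixes Df :: "('a::euclidean_space \<times> 'g::metric_space) set" and V :: "'a \<times> 'g \<Rightarrow> real"
  assumes fin: "finite (UNIV :: 'g set)"
    and tr: "trajectory Df f (I, x, \<sigma>)" "forward_complete (I, x, \<sigma>)"
    and anti: "\<And>a b \<gamma>. 0 \<le> a \<Longrightarrow> (\<forall>t\<in>{a..b}. x t \<in> base DV) \<Longrightarrow>
      antimono_on ({a..b} \<inter> \<sigma> -` {\<gamma>}) (\<lambda>t. V (x t, \<gamma>))"
    and sand: "\<And>\<xi> \<gamma>. \<xi> \<in> B \<Longrightarrow> \<xi> \<in> mode_base Df DV \<gamma> \<Longrightarrow>
      \<alpha>\<^sub>1 (norm \<xi>) \<le> V (\<xi>, \<gamma>) \<and> V (\<xi>, \<gamma>) \<le> \<alpha>\<^sub>2 (norm \<xi>)"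
    and B: "B \<subseteq> base DV"
    and \<beta>: "class_K_inf \<beta>" "\<And>s. 0 \<le> s \<Longrightarrow> s \<le> \<beta> s"
      "\<And>p s. 0 \<le> p \<Longrightarrow> 0 \<le> s \<Longrightarrow> \<alpha>\<^sub>1 p \<le> \<alpha>\<^sub>2 s \<Longrightarrow> p \<le> \<beta> s"
    and t: "0 \<le> t\<^sub>0" "t\<^sub>0 \<le> t" and xB: "\<And>u. u \<in> {t\<^sub>0..t} \<Longrightarrow> x u \<in> B"
  shows "norm (x t) \<le> (\<beta> ^^ CARD('g)) (norm (x t\<^sub>0))"
proof (rule modes_visited_bound[OF fin _ _ \<beta>(1,2)])
  show "switching_signal \<sigma>" using tr(1) by (simp add: trajectory_def)
  show "continuous_on {t\<^sub>0..t} x" by (rule trajectory_continuous_on[OF tr t(1)])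
  show "t\<^sub>0 \<le> t" "t \<le> t" using t by auto
  fix u v assume uv: "t\<^sub>0 \<le> u" "u \<le> v" "v \<le> t" "\<sigma> u = \<sigma> v"
  have base: "x w \<in> mode_base Df DV (\<sigma> w)" "x w \<in> B" if "t\<^sub>0 \<le> w" "w \<le> t" for w
  proof -
    have "w \<in> I" using that t tr(2) by (auto simp: forward_complete_def)
    then show "x w \<in> mode_base Df DV (\<sigma> w)" "x w \<in> B"
      using tr(1) xB[of w] B that by (auto simp: trajectory_def mode_base_def slice_def)
  qed
  have "antimono_on ({u..v} \<inter> \<sigma> -` {\<sigma> v}) (\<lambda>t. V (x t, \<sigma> v))"
    using uv t xB B by (intro anti) auto
  then have "V (x v, \<sigma> v) \<le> V (x u, \<sigma> v)"
    using uv by (auto simp: monotone_on_def)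
  then have "\<alpha>\<^sub>1 (norm (x v)) \<le> \<alpha>\<^sub>2 (norm (x u))"
    using sand[OF base(2,1)[of u]] sand[OF base(2,1)[of v]] uv by (auto intro: order_trans)
  then show "norm (x v) \<le> \<beta> (norm (x u))" by (intro \<beta>(3)) auto
qed

text \<open>Continuation argument: at the first time the norm reaches R, the bound by R holds up to
  that time, so the assumption makes the norm strictly smaller than R there.\<close>

lemma norm_stays_below:
  fixes x :: "real \<Rightarrow> 'a::real_normed_vector"
  assumes cont: "continuous_on {t\<^sub>0..t\<^sub>1} x" and "t\<^sub>0 \<le> t\<^sub>1" "norm (x t\<^sub>0) < R"
    and inv: "\<And>t. t\<^sub>0 \<le> t \<Longrightarrow> t \<le> t\<^sub>1 \<Longrightarrow> (\<And>u. u \<in> {t\<^sub>0..t} \<Longrightarrow> norm (x u) \<le> R) \<Longrightarrow> norm (x t) < R"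
  shows "norm (x t\<^sub>1) < R"
proof (rule ccontr)
  assume "\<not> norm (x t\<^sub>1) < R"
  define S where "S = {t\<^sub>0..t\<^sub>1} \<inter> (\<lambda>t. norm (x t)) -` {R..}"
  have "closed S"
    unfolding S_def by (intro continuous_closed_preimage continuous_on_norm cont) auto
  moreover have "bounded S"
    by (rule bounded_subset[OF bounded_closed_interval[of t\<^sub>0 t\<^sub>1]]) (auto simp: S_def)
  ultimately have "compact S" using compact_eq_bounded_closed by blast
  moreover have "S \<noteq> {}" using \<open>\<not> _\<close> assms(2) by (auto simp: S_def)
  ultimately obtain s where s: "s \<in> S" "\<And>u. u \<in> S \<Longrightarrow> s \<le> u"
    using compact_attains_inf[of S] by auto
  have st: "t\<^sub>0 \<le> s" "s \<le> t\<^sub>1" "R \<le> norm (x s)" using s by (auto simp: S_def)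
  have below: "norm (x u) < R" if "t\<^sub>0 \<le> u" "u < s" for u
    using s(2)[of u] that st by (force simp: S_def)
  have "continuous_on {t\<^sub>0..s} (\<lambda>t. norm (x t))"
    using cont st by (intro continuous_on_norm) (auto intro: continuous_on_subset)
  then obtain u where u: "t\<^sub>0 \<le> u" "u \<le> s" "norm (x u) = R"
    using IVT'[of "\<lambda>t. norm (x t)" t\<^sub>0 R s] st assms(3) by auto
  then have "u = s" using below[of u] by force
  then have "norm (x s) < R"
    using below u st by (intro inv) (auto simp: less_eq_real_def)
  with st show False by simp
qed

lemma open_base:
  assumes "class_V Df DV V"
  shows "open (base DV)"
proof -
  have "base DV = (\<Union>\<gamma>. slice DV \<gamma>)" by (force simp: base_def slice_def)
  then show ?thesis using assms by (auto simp: class_V_def)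
qed

text \<open>The estimate may start at any nonnegative time, not only at 0: attractivity restarts it
  at a late time at which the state happens to be small.\<close>

definition gain_on :: "('a::real_normed_vector, 'g) traj set \<Rightarrow> real \<Rightarrow> (real \<Rightarrow> real) \<Rightarrow> bool"
  where "gain_on \<T> r \<beta> \<longleftrightarrow> (\<forall>I x \<sigma> t\<^sub>0 t. (I, x, \<sigma>) \<in> \<T> \<longrightarrow> 0 \<le> t\<^sub>0 \<longrightarrow> norm (x t\<^sub>0) \<le> r \<longrightarrow>
    t\<^sub>0 \<le> t \<longrightarrow> norm (x t) \<le> \<beta> (norm (x t\<^sub>0)))"

text \<open>The gain estimate presupposes that the trajectory stays in the ball of radius R, which
  in turn is to follow from the estimate. Choosing r so that the iterated gain stays below R on
  [0, r] lets \<open>norm_stays_below\<close> resolve the circle.\<close>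

lemma F_weak_local_gain:
  fixes Df :: "('a::euclidean_space \<times> 'g::metric_space) set"
  assumes fin: "finite (UNIV :: 'g set)"
    and tr: "\<And>I x \<sigma>. (I, x, \<sigma>) \<in> \<T> \<Longrightarrow> trajectory Df f (I, x, \<sigma>) \<and> forward_complete (I, x, \<sigma>)"
    and FW: "F_weak_Lyapunov_pair Df f \<T> DV V W"
  obtains r \<beta> where "0 < r" "class_K_inf \<beta>" "cball 0 (\<beta> r) \<subseteq> base DV" "gain_on \<T> r \<beta>"
proof -
  have pre: "class_V Df DV V" "0 \<in> base DV"
    using FW by (auto simp: F_weak_Lyapunov_pair_def pre_Lyapunov_pair_def)
  obtain A1 a1 A2 a2 where a: "class_K A1 a1" "class_K A2 a2" "sandwiched Df DV V A1 a1 A2 a2"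
    using FW by (auto simp: F_weak_Lyapunov_pair_def pre_Lyapunov_pair_def)
  obtain r1 \<alpha>\<^sub>1 where r1: "0 < r1" "class_K_inf \<alpha>\<^sub>1" "\<And>s. s \<in> {0..r1} \<Longrightarrow> \<alpha>\<^sub>1 s = a1 s"
    using class_K_extend[OF a(1)] by metis
  obtain r2 \<alpha>\<^sub>2 where r2: "0 < r2" "class_K_inf \<alpha>\<^sub>2" "\<And>s. s \<in> {0..r2} \<Longrightarrow> \<alpha>\<^sub>2 s = a2 s"
    using class_K_extend[OF a(2)] by metis
  obtain r3 where r3: "0 < r3" "cball 0 r3 \<subseteq> base DV"
    using open_base[OF pre(1)] pre(2) by (meson open_contains_cball)
  \<comment> \<open>Up to r1 and r2 the extended comparison functions agree with the given ones; the
    ball of radius r3 lies in the open set \<open>base DV\<close>.\<close>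
  define R where "R = min r1 (min r2 r3)"
  have R: "0 < R" "R \<le> r1" "R \<le> r2" "R \<le> r3" using r1 r2 r3 by (auto simp: R_def)
  have RB: "cball 0 R \<subseteq> base DV" using r3 R by (meson order_trans subset_cball)
  obtain \<beta> where \<beta>: "class_K_inf \<beta>" "\<And>s. 0 \<le> s \<Longrightarrow> s \<le> \<beta> s"
    "\<And>p s. 0 \<le> p \<Longrightarrow> 0 \<le> s \<Longrightarrow> \<alpha>\<^sub>1 p \<le> \<alpha>\<^sub>2 s \<Longrightarrow> p \<le> \<beta> s"
    using class_K_inf_gain[OF r1(2) r2(2)] by metis
  let ?\<beta> = "\<beta> ^^ CARD('g)"
  have K: "class_K_inf ?\<beta>" "\<And>s. 0 \<le> s \<Longrightarrow> s \<le> ?\<beta> s"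
    using class_K_inf_funpow[OF \<beta>(1,2)] by auto
  obtain r where r: "0 < r" "\<And>s. 0 \<le> s \<Longrightarrow> s \<le> r \<Longrightarrow> ?\<beta> s < R"
    using class_K_inf_small[OF K(1) R(1)] by metis
  have sand: "\<alpha>\<^sub>1 (norm \<xi>) \<le> V (\<xi>, \<gamma>) \<and> V (\<xi>, \<gamma>) \<le> \<alpha>\<^sub>2 (norm \<xi>)"
    if "\<xi> \<in> cball 0 R" "\<xi> \<in> mode_base Df DV \<gamma>" for \<xi> \<gamma>
    using a(3) that R r1(3)[of "norm \<xi>"] r2(3)[of "norm \<xi>"] by (auto simp: sandwiched_def)
  have bound: "norm (x t) \<le> ?\<beta> (norm (x t\<^sub>0))"
    if T: "(I, x, \<sigma>) \<in> \<T>" and t: "0 \<le> t\<^sub>0" "t\<^sub>0 \<le> t" and "\<And>u. u \<in> {t\<^sub>0..t} \<Longrightarrow> norm (x u) \<le> R"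
    for I x \<sigma> t\<^sub>0 t
  proof (rule F_weak_gain_bound[where B = "cball 0 R" and V = V and x = x and \<sigma> = \<sigma> and DV = DV, OF fin conjunct1[OF tr[OF T]] conjunct2[OF tr[OF T]] _ sand RB \<beta> t])
    show "antimono_on ({a..b} \<inter> \<sigma> -` {\<gamma>}) (\<lambda>t. V (x t, \<gamma>))"
      if "0 \<le> a" "\<forall>t\<in>{a..b}. x t \<in> base DV" for a b \<gamma>
      using FW T that unfolding F_weak_Lyapunov_pair_def by blast
  qed (use that in auto)
  have "gain_on \<T> r ?\<beta>"
    unfolding gain_on_def
  proof (intro allI impI)
    fix I x \<sigma> t\<^sub>0 t
    assume T: "(I, x, \<sigma>) \<in> \<T>" and t: "0 \<le> t\<^sub>0" "t\<^sub>0 \<le> t" and x0: "norm (x t\<^sub>0) \<le> r"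
    have small: "norm (x u) < R" if u: "t\<^sub>0 \<le> u" for u
    proof (rule norm_stays_below[OF _ u])
      show "continuous_on {t\<^sub>0..u} x" using trajectory_continuous_on tr[OF T] t(1) by blast
      show "norm (x t\<^sub>0) < R" using K(2)[of "norm (x t\<^sub>0)"] r(2)[of "norm (x t\<^sub>0)"] x0 by auto
      show "norm (x w) < R" if "t\<^sub>0 \<le> w" "\<And>u. u \<in> {t\<^sub>0..w} \<Longrightarrow> norm (x u) \<le> R" for w
        using bound[OF T t(1) that] r(2)[of "norm (x t\<^sub>0)"] x0 by auto
    qed
    show "norm (x t) \<le> ?\<beta> (norm (x t\<^sub>0))"
      by (rule bound[OF T t]) (use small in \<open>auto simp: less_eq_real_def\<close>)
  qed
  moreover have "cball 0 (?\<beta> r) \<subseteq> base DV"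
    using r(2)[of r] r(1) RB by (meson dual_order.trans less_eq_real_def subset_cball)
  ultimately show thesis using that[OF r(1) K(1)] by blast
qed

lemma F_weak_global_gain:
  fixes Df :: "('a::euclidean_space \<times> 'g::metric_space) set"
  assumes fin: "finite (UNIV :: 'g set)"
    and tr: "\<And>I x \<sigma>. (I, x, \<sigma>) \<in> \<T> \<Longrightarrow> trajectory Df f (I, x, \<sigma>) \<and> forward_complete (I, x, \<sigma>)"
    and FW: "F_weak_Lyapunov_pair Df f \<T> DV V W"
    and glob: "base DV = UNIV" "radially_unbounded Df DV V"
  obtains \<beta> where "class_K_inf \<beta>" "\<And>r. gain_on \<T> r \<beta>"
proof -
  obtain \<alpha>\<^sub>1 \<alpha>\<^sub>2 where \<alpha>: "class_K_inf \<alpha>\<^sub>1" "class_K_inf \<alpha>\<^sub>2" "sandwiched Df DV V {0..} \<alpha>\<^sub>1 {0..} \<alpha>\<^sub>2"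
    using glob(2) by (auto simp: radially_unbounded_def)
  obtain \<beta> where \<beta>: "class_K_inf \<beta>" "\<And>s. 0 \<le> s \<Longrightarrow> s \<le> \<beta> s"
    "\<And>p s. 0 \<le> p \<Longrightarrow> 0 \<le> s \<Longrightarrow> \<alpha>\<^sub>1 p \<le> \<alpha>\<^sub>2 s \<Longrightarrow> p \<le> \<beta> s"
    using class_K_inf_gain[OF \<alpha>(1,2)] by metis
  have "norm (x t) \<le> (\<beta> ^^ CARD('g)) (norm (x t\<^sub>0))"
    if T: "(I, x, \<sigma>) \<in> \<T>" and t: "0 \<le> t\<^sub>0" "t\<^sub>0 \<le> t" for I x \<sigma> t\<^sub>0 t
  proof (rule F_weak_gain_bound[where B = UNIV and V = V and x = x and \<sigma> = \<sigma> and DV = DV, OF fin conjunct1[OF tr[OF T]] conjunct2[OF tr[OF T]] _ _ _ \<beta> t])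
    show "antimono_on ({a..b} \<inter> \<sigma> -` {\<gamma>}) (\<lambda>t. V (x t, \<gamma>))"
      if "0 \<le> a" "\<forall>t\<in>{a..b}. x t \<in> base DV" for a b \<gamma>
      using FW T that unfolding F_weak_Lyapunov_pair_def by blast
    show "\<alpha>\<^sub>1 (norm \<xi>) \<le> V (\<xi>, \<gamma>) \<and> V (\<xi>, \<gamma>) \<le> \<alpha>\<^sub>2 (norm \<xi>)" if "\<xi> \<in> mode_base Df DV \<gamma>" for \<xi> \<gamma>
      using \<alpha>(3) that by (auto simp: sandwiched_def)
  qed (use glob in auto)
  then have "gain_on \<T> r (\<beta> ^^ CARD('g))" for r by (auto simp: gain_on_def)
  with class_K_inf_funpow(1)[OF \<beta>(1,2)] show thesis using that by blast
qed

subsection \<open>Absolutely continuous curves\<close>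

text \<open>Outer regularity: since N is null, the excess U - N has the same measure as U.\<close>

lemma negligible_imp_small_open_cover:
  fixes N :: "'a::euclidean_space set"
  assumes "negligible N" "0 < e"
  obtains U where "open U" "N \<subseteq> U" "U \<in> lmeasurable" "measure lebesgue U < e"
proof -
  have N: "N \<in> null_sets lebesgue"
    using assms(1) negligible_iff_null_sets by blast
  then obtain U where U: "open U" "N \<subseteq> U" "U - N \<in> lmeasurable" "emeasure lebesgue (U - N) < ennreal e"
    using sets_lebesgue_outer_open[of N e] assms(2) by (metis null_setsD2)
  have Um: "U \<in> lmeasurable"
    using U N by (metis borel_open measurable_Diff_null_set sets_completionI_sets sets_lborel)
  have "measure lebesgue (U - N) = measure lebesgue U"
    using N Um by (simp add: fmeasurableD measure_Diff_null_set)
  with U have "measure lebesgue U < e"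
    by (simp add: emeasure_eq_measure2 ennreal_less_iff)
  with U Um show thesis using that by blast
qed

text \<open>Absolute continuity speaks of sets of endpoint pairs, a division of tagged intervals.
  Degenerate intervals contribute nothing and are dropped; distinct remaining ones have disjoint
  nonempty interiors, so passing to endpoints is injective. Their overlaps are finite, so their
  total length is the measure of their union and hence at most that of U.\<close>

lemma tagged_division_variation_small:
  fixes x :: "real \<Rightarrow> 'a::euclidean_space"
  assumes p: "p tagged_division_of {a..b}" and q: "q \<subseteq> p"
    and U: "\<And>t K. (t, K) \<in> q \<Longrightarrow> K \<subseteq> U" "U \<in> lmeasurable" "measure lebesgue U < \<delta>"
    and ac: "\<And>P. finite P \<Longrightarrow> (\<forall>(s, t)\<in>P. a \<le> s \<and> s < t \<and> t \<le> b) \<Longrightarrow>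
      (\<forall>(s, t)\<in>P. \<forall>(s', t')\<in>P. (s, t) \<noteq> (s', t') \<longrightarrow> {s<..<t} \<inter> {s'<..<t'} = {}) \<Longrightarrow>
      (\<Sum>(s, t)\<in>P. t - s) < \<delta> \<Longrightarrow> (\<Sum>(s, t)\<in>P. norm (x t - x s)) < \<epsilon>"
  shows "(\<Sum>(t, K)\<in>q. norm (x (Sup K) - x (Inf K))) < \<epsilon>"
proof -
  define q' where "q' = {(t, K) \<in> q. Inf K < Sup K}"
  define F where "F = (\<lambda>(t::real, K::real set). (Inf K, Sup K))"
  have finq: "finite q"
    using p q finite_subset tagged_division_ofD(1) by metis
  have "q' \<subseteq> q" by (auto simp: q'_def)
  with finq have finq': "finite q'" by (rule finite_subset[rotated])
  have itv: "\<exists>u v. K = {u..v} \<and> u \<le> v \<and> a \<le> u \<and> v \<le> b" if tK: "(t, K) \<in> q" for t K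
  proof -
    have "(t, K) \<in> p" using tK q by auto
    then obtain u v where "K = {u..v}" "t \<in> K" "K \<subseteq> {a..b}"
      using tagged_division_ofD[OF p] by (metis box_real(2))
    then show ?thesis by auto
  qed
  have K: "K = {Inf K..Sup K} \<and> a \<le> Inf K \<and> Sup K \<le> b \<and> Inf K \<le> Sup K" if "(t, K) \<in> q" for t K
    using itv[OF that] by auto
  have int: "interior K = {Inf K<..<Sup K}" if "(t, K) \<in> q" for t K
    using K[OF that] by (metis interior_atLeastAtMost_real)
  have disj: "{Inf K<..<Sup K} \<inter> {Inf K'<..<Sup K'} = {}"
    if "(t, K) \<in> q" "(t', K') \<in> q" "(t, K) \<noteq> (t', K')" for t K t' K'
    using tagged_division_ofD(5)[OF p, of t K t' K'] that q int by auto
  have inj: "inj_on F q'"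
  proof (rule inj_onI)
    fix k k' assume k: "k \<in> q'" "k' \<in> q'" "F k = F k'"
    show "k = k'"
    proof (rule ccontr)
      assume "k \<noteq> k'"
      then have "{fst (F k)<..<snd (F k)} \<inter> {fst (F k')<..<snd (F k')} = {}"
        using disj[of "fst k" "snd k" "fst k'" "snd k'"] k by (auto simp: q'_def F_def prod_eq_iff)
      moreover have "fst (F k) < snd (F k)" using k by (auto simp: q'_def F_def)
      ultimately show False using k by auto
    qed
  qed
  have "(\<Sum>(s, t)\<in>F ` q'. t - s) = (\<Sum>k\<in>q'. snd (F k) - fst (F k))"
    by (simp add: sum.reindex[OF inj] case_prod_beta)
  also have "\<dots> = (\<Sum>k\<in>q'. measure lebesgue (snd k))"
  proof (rule sum.cong[OF refl])
    fix k assume k: "k \<in> q'"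
    obtain t K' where tk: "k = (t, K')" by force
    with k have q: "(t, K') \<in> q" by (auto simp: q'_def)
    show "snd (F k) - fst (F k) = measure lebesgue (snd k)"
    proof -
      obtain u v where "K' = {u..v}" "u \<le> v" using itv[OF q] by blast
      then show ?thesis by (simp add: tk F_def)
    qed
  qed
  also have "\<dots> = measure lebesgue (\<Union>(snd ` q'))"
  proof (rule measure_negligible_finite_Union_image[symmetric, OF finq'])
    show "snd k \<in> lmeasurable" if "k \<in> q'" for k
      using itv[of "fst k" "snd k"] that by (auto simp: q'_def)
    show "pairwise (\<lambda>x y. negligible (snd x \<inter> snd y)) q'"
    proof (rule pairwiseI)
      fix k k' assume k: "k \<in> q'" "k' \<in> q'" "k \<noteq> k'"
      obtain t K1 t' K2 where e: "k = (t, K1)" "k' = (t', K2)" by force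
      then have kq: "(t, K1) \<in> q" "(t', K2) \<in> q" using k by (auto simp: q'_def)
      have "{Inf K1<..<Sup K1} \<inter> {Inf K2<..<Sup K2} = {}"
        using disj[OF kq] k e by auto
      moreover have "Inf K1 < Sup K1" "Inf K2 < Sup K2" using k e by (auto simp: q'_def)
      ultimately have "K1 \<inter> K2 \<subseteq> {Inf K1, Sup K1}"
      proof -
        have "Sup K1 \<le> Inf K2 \<or> Sup K2 \<le> Inf K1"
        proof (rule ccontr)
          assume "\<not> ?thesis"
          then have "max (Inf K1) (Inf K2) < min (Sup K1) (Sup K2)"
            using \<open>Inf K1 < Sup K1\<close> \<open>Inf K2 < Sup K2\<close> by auto
          then obtain w where "max (Inf K1) (Inf K2) < w" "w < min (Sup K1) (Sup K2)"
            using dense by blast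
          then have "w \<in> {Inf K1<..<Sup K1} \<inter> {Inf K2<..<Sup K2}" by auto
          then show False using \<open>_ = {}\<close> by auto
        qed
        moreover have "w \<in> {Inf K1..Sup K1}" "w \<in> {Inf K2..Sup K2}" if "w \<in> K1 \<inter> K2" for w
          using that K[OF kq(1)] K[OF kq(2)] by auto
        ultimately show ?thesis by force
      qed
      then have "finite (K1 \<inter> K2)" by (rule finite_subset) auto
      then show "negligible (snd k \<inter> snd k')" using e by (auto intro: negligible_finite)
    qed
  qed
  also have "\<dots> \<le> measure lebesgue U"
  proof (rule measure_mono_fmeasurable[OF _ _ U(2)])
    show "\<Union>(snd ` q') \<subseteq> U" using U(1) by (force simp: q'_def)
    show "\<Union>(snd ` q') \<in> sets lebesgue"
    proof (rule sets.finite_UN[OF finq'])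
      fix k assume "k \<in> q'"
      then obtain u v where "snd k = {u..v}"
        using itv[of "fst k" "snd k"] by (auto simp: q'_def)
      then show "snd k \<in> sets lebesgue" by simp
    qed
  qed
  also have "\<dots> < \<delta>" by (rule U(3))
  finally have len: "(\<Sum>(s, t)\<in>F ` q'. t - s) < \<delta>" .
  have "(\<Sum>(s, t)\<in>F ` q'. norm (x t - x s)) < \<epsilon>"
  proof (rule ac[OF _ _ _ len])
    show "finite (F ` q')" using finq' by simp
    show "\<forall>(s, t)\<in>F ` q'. a \<le> s \<and> s < t \<and> t \<le> b"
      using K by (auto simp: q'_def F_def)
    show "\<forall>(s, t)\<in>F ` q'. \<forall>(s', t')\<in>F ` q'. (s, t) \<noteq> (s', t') \<longrightarrow> {s<..<t} \<inter> {s'<..<t'} = {}"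
    proof clarify
      fix s t s' t' u K1 u' K2
      assume a: "(u, K1) \<in> q'" "(u', K2) \<in> q'" "(s, t) = F (u, K1)" "(s', t') = F (u', K2)"
        "{s<..<t} \<inter> {s'<..<t'} \<noteq> {}"
      then have "(u, K1) = (u', K2)"
        using disj[of u K1 u' K2] by (auto simp: q'_def F_def)
      with a show "s = s' \<and> t = t'" by (auto simp: F_def)
    qed
  qed
  moreover have "(\<Sum>(s, t)\<in>F ` q'. norm (x t - x s)) = (\<Sum>(t, K)\<in>q'. norm (x (Sup K) - x (Inf K)))"
    unfolding sum.reindex[OF inj] by (simp add: case_prod_beta F_def)
  moreover have "(\<Sum>(t, K)\<in>q'. norm (x (Sup K) - x (Inf K))) = (\<Sum>(t, K)\<in>q. norm (x (Sup K) - x (Inf K)))"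
  proof (rule sum.mono_neutral_left[OF finq])
    show "q' \<subseteq> q" by (auto simp: q'_def)
    show "\<forall>i\<in>q - q'. (case i of (t, K) \<Rightarrow> norm (x (Sup K) - x (Inf K))) = 0"
    proof clarify
      fix t K' assume a: "(t, K') \<in> q" "(t, K') \<notin> q'"
      then have "Inf K' = Sup K'" using K[OF a(1)] by (auto simp: q'_def)
      then show "norm (x (Sup K') - x (Inf K')) = 0" by simp
    qed
  qed
  ultimately show ?thesis by simp
qed

text \<open>At tags outside \<open>N\<close> the gauge is the one of the classical proof.  At tags in \<open>N\<close> it confines the
  intervals to a small open cover of \<open>N\<close>, so absolute continuity bounds their contribution.\<close>

theorem fundamental_theorem_of_calculus_abs_cont:
  fixes x :: "real \<Rightarrow> 'a::euclidean_space"
  assumes ab: "a \<le> b" and ac: "abs_cont_on_interval a b x" and N: "negligible N"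
    and der: "\<And>t. t \<in> {a..b} - N \<Longrightarrow> (x has_vector_derivative h t) (at t within {a..b})"
  shows "(h has_integral (x b - x a)) {a..b}"
proof -
  \<comment> \<open>With integrand 0 on N, the Riemann terms with tags in N vanish and only
    increments of x remain there. The change on a negligible set is undone at the end.\<close>
  define g where "g t = (if t \<in> N then 0 else h t)" for t
  have "(g has_integral (x b - x a)) {a..b}"
    unfolding has_integral_real
  proof (intro allI impI)
    fix e :: real assume "e > 0"
    \<comment> \<open>Half of e is spent on tags outside N, the other half on the variation over
      tags in N; the + 1 covers the case a = b.\<close>
    define e1 where "e1 = e / (2 * (b - a + 1))"
    have e1: "e1 > 0" "e1 * (b - a) \<le> e / 2"
      using \<open>e > 0\<close> ab by (auto simp: e1_def field_simps)
    have "\<exists>\<delta>>0. \<forall>P :: (real \<times> real) set.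
      finite P \<and> (\<forall>(s, t)\<in>P. a \<le> s \<and> s < t \<and> t \<le> b) \<and>
      (\<forall>(s, t)\<in>P. \<forall>(s', t')\<in>P. (s, t) \<noteq> (s', t') \<longrightarrow> {s<..<t} \<inter> {s'<..<t'} = {}) \<and>
      (\<Sum>(s, t)\<in>P. t - s) < \<delta>
      \<longrightarrow> (\<Sum>(s, t)\<in>P. norm (x t - x s)) < e / 2"
      by (rule ac[unfolded abs_cont_on_interval_def, rule_format]) (use \<open>e > 0\<close> in simp)
    then obtain \<delta> where \<delta>: "\<delta> > 0" and acP: "\<And>P. finite P \<Longrightarrow> (\<forall>(s, t)\<in>P. a \<le> s \<and> s < t \<and> t \<le> b) \<Longrightarrow>
      (\<forall>(s, t)\<in>P. \<forall>(s', t')\<in>P. (s, t) \<noteq> (s', t') \<longrightarrow> {s<..<t} \<inter> {s'<..<t'} = {}) \<Longrightarrow>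
      (\<Sum>(s, t)\<in>P. t - s) < \<delta> \<Longrightarrow> (\<Sum>(s, t)\<in>P. norm (x t - x s)) < e / 2"
      by (elim exE conjE) (rule that, assumption, blast)
    obtain U where U: "open U" "N \<subseteq> U" "U \<in> lmeasurable" "measure lebesgue U < \<delta>"
      using negligible_imp_small_open_cover[OF N \<delta>] .
    have "\<exists>d>0. (t \<in> N \<longrightarrow> ball t d \<subseteq> U) \<and> (t \<in> {a..b} - N \<longrightarrow>
       (\<forall>y\<in>{a..b}. norm (y - t) < d \<longrightarrow> norm (x y - x t - (y - t) *\<^sub>R h t) \<le> e1 * norm (y - t)))" for t
    proof (cases "t \<in> N")
      case True
      then show ?thesis using U by (metis DiffD2 open_contains_ball subset_eq)
    next
      case False
      then show ?thesis
        using der[of t] e1(1) unfolding has_vector_derivative_def has_derivative_within_alt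
        by (cases "t \<in> {a..b}") (auto intro: exI[of _ 1])
    qed
    then obtain d where d: "\<And>t. d t > 0" "\<And>t. t \<in> N \<Longrightarrow> ball t (d t) \<subseteq> U"
      "\<And>t y. t \<in> {a..b} - N \<Longrightarrow> y \<in> {a..b} \<Longrightarrow> norm (y - t) < d t \<Longrightarrow>
         norm (x y - x t - (y - t) *\<^sub>R h t) \<le> e1 * norm (y - t)"
      by metis
    show "\<exists>\<gamma>. gauge \<gamma> \<and> (\<forall>p. p tagged_division_of {a..b} \<and> \<gamma> fine p \<longrightarrow>
      norm ((\<Sum>(t, K)\<in>p. measure lborel K *\<^sub>R g t) - (x b - x a)) < e)"
    proof (rule exI[of _ "\<lambda>t. ball t (d t)"], safe)
      show "gauge (\<lambda>t. ball t (d t))" using d(1) gauge_ball_dependent by blast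
      fix p assume p: "p tagged_division_of {a..b}" and fine: "(\<lambda>t. ball t (d t)) fine p"
      define q where "q = {(t, K) \<in> p. t \<in> N}"
      have finp: "finite p" using p by auto
      have qp: "q \<subseteq> p" by (auto simp: q_def)
      have split: "sum F p = sum F q + sum F (p - q)" for F :: "real \<times> real set \<Rightarrow> 'a"
        using finp qp by (metis add.commute sum.subset_diff)
      have len: "(\<Sum>(t, K)\<in>p. Sup K - Inf K) = b - a"
        using additive_tagged_division_1[OF ab p, of "\<lambda>t. t"] by simp
      have bd: "(\<Sum>(t, K)\<in>p. x (Sup K) - x (Inf K)) = x b - x a"
        using additive_tagged_division_1[OF ab p, of x] .
      have itv: "K = {Inf K..Sup K} \<and> a \<le> Inf K \<and> Sup K \<le> b \<and> Inf K \<le> t \<and> t \<le> Sup K \<and>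
          measure lborel K = Sup K - Inf K" if tK: "(t, K) \<in> p" for t K
      proof -
        obtain u v where "K = {u..v}" "t \<in> K" "K \<subseteq> {a..b}"
          using tagged_division_ofD[OF p] tK by (metis box_real(2))
        then show ?thesis by auto
      qed
      have small: "(\<Sum>(t, K)\<in>q. norm (x (Sup K) - x (Inf K))) < e / 2"
      proof (rule tagged_division_variation_small[OF p qp _ U(3,4) acP])
        show "K \<subseteq> U" if "(t, K) \<in> q" for t K
          using that fine d(2)[of t] by (force simp: q_def fine_def)
      qed
      have "norm ((\<Sum>(t, K)\<in>p. measure lborel K *\<^sub>R g t) - (x b - x a))
          = norm (\<Sum>(t, K)\<in>p. measure lborel K *\<^sub>R g t - (x (Sup K) - x (Inf K)))"
        unfolding bd[symmetric] by (simp add: sum_subtractf case_prod_beta)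
      also have "\<dots> \<le> norm (\<Sum>(t, K)\<in>q. measure lborel K *\<^sub>R g t - (x (Sup K) - x (Inf K)))
          + norm (\<Sum>(t, K)\<in>p - q. measure lborel K *\<^sub>R g t - (x (Sup K) - x (Inf K)))"
        unfolding split by (rule norm_triangle_ineq)
      also have "norm (\<Sum>(t, K)\<in>q. measure lborel K *\<^sub>R g t - (x (Sup K) - x (Inf K)))
          \<le> (\<Sum>(t, K)\<in>q. norm (x (Sup K) - x (Inf K)))"
        by (rule sum_norm_le) (auto simp: q_def g_def norm_minus_commute)
      also have "norm (\<Sum>(t, K)\<in>p - q. measure lborel K *\<^sub>R g t - (x (Sup K) - x (Inf K)))
          \<le> (\<Sum>(t, K)\<in>p - q. e1 * (Sup K - Inf K))"
      proof (rule sum_norm_le, clarify)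
        fix t K assume tK: "(t, K) \<in> p" "(t, K) \<notin> q"
        let ?u = "Inf K" and ?v = "Sup K"
        have t: "t \<in> {a..b} - N" using itv[OF tK(1)] tK by (auto simp: q_def)
        have "K \<subseteq> ball t (d t)" using fine tK(1) by (auto simp: fine_def)
        moreover have "?u \<in> K" "?v \<in> K" using itv[OF tK(1)] by (metis atLeastAtMost_iff order.trans order_refl)+
        ultimately have "norm (?u - t) < d t" "norm (?v - t) < d t"
          by (auto simp: dist_norm norm_minus_commute)
        then have "norm (x ?u - x t - (?u - t) *\<^sub>R h t) \<le> e1 * norm (?u - t)"
          "norm (x ?v - x t - (?v - t) *\<^sub>R h t) \<le> e1 * norm (?v - t)"
          using d(3)[OF t, of ?u] d(3)[OF t, of ?v] itv[OF tK(1)] by (metis atLeastAtMost_iff order.trans)+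
        \<comment> \<open>Both ends of K are compared with the tag t, where the derivative is known.
          As t lies between them, the two error bounds add up to e1 times the length of K.\<close>
        moreover have "measure lborel K *\<^sub>R g t - (x ?v - x ?u)
            = (x ?u - x t - (?u - t) *\<^sub>R h t) - (x ?v - x t - (?v - t) *\<^sub>R h t)"
        proof -
          have c: "measure lborel K = ?v - ?u" using itv[OF tK(1)] by blast
          show ?thesis using t unfolding c by (simp add: g_def algebra_simps)
        qed
        ultimately have "norm (measure lborel K *\<^sub>R g t - (x ?v - x ?u)) \<le> e1 * norm (?u - t) + e1 * norm (?v - t)"
          by (simp only:) (rule order_trans[OF norm_triangle_ineq4 add_mono])
        also have "\<dots> = e1 * (?v - ?u)"
          using itv[OF tK(1)] by (simp add: algebra_simps)
        finally show "norm (measure lborel K *\<^sub>R g t - (x ?v - x ?u)) \<le> e1 * (?v - ?u)" .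
      qed
      also have "(\<Sum>(t, K)\<in>p - q. e1 * (Sup K - Inf K)) \<le> (\<Sum>(t, K)\<in>p. e1 * (Sup K - Inf K))"
      proof (rule sum_mono2[OF finp])
        show "p - q \<subseteq> p" by blast
        fix k assume k: "k \<in> p - (p - q)"
        obtain t K where tK: "k = (t, K)" by force
        with k have "(t, K) \<in> p" by auto
        from itv[OF this] show "0 \<le> (case k of (t, K) \<Rightarrow> e1 * (Sup K - Inf K))"
          using e1 tK by auto
      qed
      also have "\<dots> = e1 * (b - a)"
        unfolding len[symmetric] by (simp add: sum_distrib_left case_prod_beta)
      finally show "norm ((\<Sum>(t, K)\<in>p. measure lborel K *\<^sub>R g t) - (x b - x a)) < e"
        using small e1 by simp
    qed
  qed
  then show ?thesis
    by (rule has_integral_spike[OF N, rotated]) (auto simp: g_def)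
qed

subsection \<open>Limits of solutions\<close>

text \<open>The Arzela-Ascoli argument for curves whose domains vary: a diagonal subsequence
  converges on a countable dense part of J, and the common Lipschitz constant spreads convergence to
  all of J. Each time only has to lie in the domains eventually, so J may be unbounded.\<close>

lemma equi_Lipschitz_convergent_subsequence:
  fixes y :: "nat \<Rightarrow> real \<Rightarrow> 'a::euclidean_space"
  assumes ev: "\<And>t. t \<in> J \<Longrightarrow> \<forall>\<^sub>F k in sequentially. t \<in> Jk k"
    and bound: "\<And>k t. t \<in> Jk k \<Longrightarrow> norm (y k t) \<le> B"
    and lip: "\<And>k s t. s \<in> Jk k \<Longrightarrow> t \<in> Jk k \<Longrightarrow> norm (y k t - y k s) \<le> M * \<bar>t - s\<bar>"
  obtains r z where "strict_mono (r :: nat \<Rightarrow> nat)" "\<And>t. t \<in> J \<Longrightarrow> (\<lambda>k. y (r k) t) \<longlonglongrightarrow> z t"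
proof -
  obtain D where D: "countable D" "D \<subseteq> J" "J \<subseteq> closure D"
    using separable by blast
  \<comment> \<open>The diagonal argument wants a bound at every index, including those for which t
    is outside \<open>Jk k\<close>; the default 0 provides it and has no effect on the
    limit.\<close>
  define y' where "y' k t = (if t \<in> Jk k then y k t else 0)" for k t
  have "norm (y' k t) \<le> \<bar>B\<bar>" for k t
    using bound[of t k] by (auto simp: y'_def)
  then obtain r where r: "strict_mono (r :: nat \<Rightarrow> nat)" "\<And>t. t \<in> D \<Longrightarrow> \<exists>l. (\<lambda>k. y' (r k) t) \<longlonglongrightarrow> l"
    using function_convergent_subsequence[OF D(1), of y' "\<bar>B\<bar>"] by blast
  have evr: "\<forall>\<^sub>F k in sequentially. t \<in> Jk (r k)" if "t \<in> J" for t
    using eventually_subseq[OF r(1) ev[OF that]] .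
  have "convergent (\<lambda>k. y (r k) t)" if t: "t \<in> J" for t
  proof (rule Cauchy_convergent, rule metric_CauchyI)
    fix e :: real assume "0 < e"
    \<comment> \<open>Moving from t to a point of D within d costs at most e / 3 on each side; the +
      1 avoids division by zero.\<close>
    define d where "d = e / (3 * (\<bar>M\<bar> + 1))"
    have "0 < d" using \<open>0 < e\<close> by (simp add: d_def add_nonneg_pos)
    then obtain q where q: "q \<in> D" "dist q t < d"
      using D(3) t by (meson closure_approachable subsetD)
    have "M * \<bar>t - q\<bar> \<le> (\<bar>M\<bar> + 1) * d"
      using q(2) by (intro mult_mono) (auto simp: dist_real_def)
    also have "\<dots> = e / 3" by (simp add: d_def field_simps)
    finally have Mq: "M * \<bar>t - q\<bar> \<le> e / 3" .
    have "Cauchy (\<lambda>k. y' (r k) q)" using r(2)[OF q(1)] by (auto intro: LIMSEQ_imp_Cauchy)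
    then obtain N1 where N1: "\<And>m n. N1 \<le> m \<Longrightarrow> N1 \<le> n \<Longrightarrow> dist (y' (r m) q) (y' (r n) q) < e / 3"
      using \<open>0 < e\<close> by (metis metric_CauchyD zero_less_divide_iff zero_less_numeral)
    have "\<forall>\<^sub>F k in sequentially. t \<in> Jk (r k) \<and> q \<in> Jk (r k)"
      using evr[OF t] evr[of q] q D(2) by (intro eventually_conj) auto
    then obtain N2 where N2: "\<And>k. N2 \<le> k \<Longrightarrow> t \<in> Jk (r k) \<and> q \<in> Jk (r k)"
      by (auto simp: eventually_sequentially)
    have "dist (y (r m) t) (y (r n) t) < e" if "max N1 N2 \<le> m" "max N1 N2 \<le> n" for m n
    proof -
      have "norm (y (r m) t - y (r m) q) \<le> e / 3" "norm (y (r n) t - y (r n) q) \<le> e / 3"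
        using lip[of q "r m" t] lip[of q "r n" t] N2[of m] N2[of n] Mq that by auto
      moreover have "norm (y (r m) q - y (r n) q) < e / 3"
        using N1[of m n] N2[of m] N2[of n] that by (simp add: y'_def dist_norm)
      ultimately show ?thesis
        using norm_triangle_ineq[of "y (r m) t - y (r m) q" "y (r m) q - y (r n) q"]
          norm_triangle_ineq4[of "y (r m) t - y (r n) q" "y (r n) t - y (r n) q"]
        by (simp add: dist_norm)
    qed
    then show "\<exists>N. \<forall>m\<ge>N. \<forall>n\<ge>N. dist (y (r m) t) (y (r n) t) < e" by blast
  qed
  then have "\<forall>t\<in>J. \<exists>l. (\<lambda>k. y (r k) t) \<longlonglongrightarrow> l" by (auto simp: convergent_def)
  then show thesis using that r(1) by metis
qed

text \<open>A bound for g on the compact set K serves twice: as common Lipschitz constant, which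
  gives a convergent subsequence, and as dominating function, which lets the integral equation pass
  to the limit.\<close>

lemma limit_solution:
  fixes y :: "nat \<Rightarrow> real \<Rightarrow> 'a::euclidean_space" and g :: "'a \<Rightarrow> 'a"
  assumes K: "compact K" "continuous_on K g"
    and Jk: "\<And>k. is_interval (Jk k)"
    and ev: "\<And>t. t \<in> J \<Longrightarrow> \<forall>\<^sub>F k in sequentially. t \<in> Jk k"
    and yK: "\<And>k t. t \<in> Jk k \<Longrightarrow> y k t \<in> K"
    and sol: "\<And>k s t. s \<in> Jk k \<Longrightarrow> t \<in> Jk k \<Longrightarrow> s \<le> t \<Longrightarrow>
      ((\<lambda>u. g (y k u)) has_integral (y k t - y k s)) {s..t}"
  obtains r z M where "strict_mono (r :: nat \<Rightarrow> nat)" "\<And>t. t \<in> J \<Longrightarrow> (\<lambda>k. y (r k) t) \<longlonglongrightarrow> z t"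
    "\<And>t. t \<in> J \<Longrightarrow> z t \<in> K"
    "\<And>s t. s \<in> J \<Longrightarrow> t \<in> J \<Longrightarrow> norm (z t - z s) \<le> M * \<bar>t - s\<bar>"
    "\<And>s t. s \<le> t \<Longrightarrow> {s..t} \<subseteq> J \<Longrightarrow> ((\<lambda>u. g (z u)) has_integral (z t - z s)) {s..t}"
proof -
  obtain B where B: "\<And>\<xi>. \<xi> \<in> K \<Longrightarrow> norm \<xi> \<le> B"
    using compact_imp_bounded[OF K(1)] by (auto simp: bounded_iff)
  have "bounded (g ` K)" using K by (intro compact_imp_bounded compact_continuous_image)
  then obtain M0 where "\<And>\<xi>. \<xi> \<in> K \<Longrightarrow> norm (g \<xi>) \<le> M0" by (auto simp: bounded_iff)
  then obtain M where M: "0 \<le> M" "\<And>\<xi>. \<xi> \<in> K \<Longrightarrow> norm (g \<xi>) \<le> M"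
    using that[of "\<bar>M0\<bar>"] by force
  have sub: "{s..t} \<subseteq> Jk k" if "s \<in> Jk k" "t \<in> Jk k" for s t k
    using Jk[of k, unfolded is_interval_1] that by (meson atLeastAtMost_iff subsetI)
  have lip': "norm (y k t - y k s) \<le> M * \<bar>t - s\<bar>" if "s \<in> Jk k" "t \<in> Jk k" "s \<le> t" for k s t
  proof -
    have "norm (y k t - y k s) \<le> M * measure lborel (cbox s t)"
      by (rule has_integral_bound[OF M(1)])
        (use sol[OF that] sub[OF that(1,2)] M(2) yK in auto)
    then show ?thesis using that by simp
  qed
  have lip: "norm (y k t - y k s) \<le> M * \<bar>t - s\<bar>" if "s \<in> Jk k" "t \<in> Jk k" for k s t
    using lip'[of s k t] lip'[of t k s] that by (cases "s \<le> t") (auto simp: norm_minus_commute)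
  obtain r z where r: "strict_mono (r :: nat \<Rightarrow> nat)" and z: "\<And>t. t \<in> J \<Longrightarrow> (\<lambda>k. y (r k) t) \<longlonglongrightarrow> z t"
  proof (rule equi_Lipschitz_convergent_subsequence[of J Jk y B M])
    show "\<forall>\<^sub>F k in sequentially. t \<in> Jk k" if "t \<in> J" for t by (rule ev[OF that])
    show "norm (y k t) \<le> B" if "t \<in> Jk k" for k t using B yK that by blast
  qed (use lip in auto)
  have evr: "\<forall>\<^sub>F k in sequentially. t \<in> Jk (r k)" if "t \<in> J" for t
    using eventually_subseq[OF r ev[OF that]] .
  have zK: "z t \<in> K" if "t \<in> J" for t
  proof (rule Lim_in_closed_set[OF compact_imp_closed[OF K(1)] _ _ z[OF that]])
    show "\<forall>\<^sub>F k in sequentially. y (r k) t \<in> K"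
      using evr[OF that] by eventually_elim (rule yK)
  qed simp
  have zlip: "norm (z t - z s) \<le> M * \<bar>t - s\<bar>" if "s \<in> J" "t \<in> J" for s t
  proof (rule tendsto_upperbound)
    show "(\<lambda>k. norm (y (r k) t - y (r k) s)) \<longlonglongrightarrow> norm (z t - z s)"
      using z that by (intro tendsto_intros)
    show "\<forall>\<^sub>F k in sequentially. norm (y (r k) t - y (r k) s) \<le> M * \<bar>t - s\<bar>"
      using evr[OF that(1)] evr[OF that(2)] by eventually_elim (rule lip)
  qed simp
  have "((\<lambda>u. g (z u)) has_integral (z t - z s)) {s..t}" if st: "s \<le> t" "{s..t} \<subseteq> J" for s t
  proof -
    have "\<forall>\<^sub>F k in sequentially. s \<in> Jk (r k) \<and> t \<in> Jk (r k)"
      using st by (intro eventually_conj evr) auto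
    \<comment> \<open>The early curves need not be defined on [s, t]; they are skipped by shifting
      the index by N.\<close>
    then obtain N where N: "\<And>k. N \<le> k \<Longrightarrow> s \<in> Jk (r k) \<and> t \<in> Jk (r k)"
      by (auto simp: eventually_sequentially)
    show ?thesis
    proof (rule has_integral_dominated_convergence)
      show "((\<lambda>u. g (y (r (k + N)) u)) has_integral (y (r (k + N)) t - y (r (k + N)) s)) {s..t}" for k
        using sol N[of "k + N"] st by auto
      show "(\<lambda>u. M) integrable_on {s..t}" by (rule integrable_const_ivl)
      show "\<forall>u\<in>{s..t}. norm (g (y (r (k + N)) u)) \<le> M" for k
        using M(2) yK sub N[of "k + N"] by (meson le_add2 subsetD)
      show "\<forall>u\<in>{s..t}. (\<lambda>k. g (y (r (k + N)) u)) \<longlonglongrightarrow> g (z u)"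
      proof
        fix u assume u: "u \<in> {s..t}"
        show "(\<lambda>k. g (y (r (k + N)) u)) \<longlonglongrightarrow> g (z u)"
        proof (rule continuous_on_tendsto_compose[OF K(2)])
          show "(\<lambda>k. y (r (k + N)) u) \<longlonglongrightarrow> z u"
            using LIMSEQ_ignore_initial_segment[OF z[of u], of N] u st by auto
          show "z u \<in> K" using zK u st by auto
          show "\<forall>\<^sub>F k in sequentially. y (r (k + N)) u \<in> K"
            using yK sub N u by (intro always_eventually allI) (meson le_add2 subsetD)
        qed
      qed
      show "(\<lambda>k. y (r (k + N)) t - y (r (k + N)) s) \<longlonglongrightarrow> z t - z s"
        using LIMSEQ_ignore_initial_segment[OF z[of t], of N]
          LIMSEQ_ignore_initial_segment[OF z[of s], of N] st by (intro tendsto_diff) auto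
    qed
  qed
  with r z zK zlip show thesis using that by blast
qed

section \<open>Regularity of the limit curves\<close>

text \<open>A continuous integrand upgrades the integral equation to a derivative at every time,
  one-sided at the ends of the interval.\<close>

lemma integral_equation_has_vector_derivative:
  fixes z h :: "real \<Rightarrow> 'a::banach"
  assumes "\<And>t. t \<in> {a..b} \<Longrightarrow> (h has_integral (z t - z a)) {a..t}"
    and "continuous_on {a..b} h" and t: "t \<in> {a..b}"
  shows "(z has_vector_derivative h t) (at t within {a..b})"
proof (rule has_vector_derivative_transform[OF t])
  show "((\<lambda>u. z a + integral {a..u} h) has_vector_derivative h t) (at t within {a..b})"
    using has_vector_derivative_add[OF has_vector_derivative_const[of "z a"]
        integral_has_vector_derivative[OF assms(2) t]] by simp
  show "z u = z a + integral {a..u} h" if "u \<in> {a..b}" for u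
    using integral_unique[OF assms(1)[OF that]] by simp
qed

lemma Lipschitz_imp_locally_abs_cont_on:
  fixes z :: "real \<Rightarrow> 'a::real_normed_vector"
  assumes lip: "\<And>s t. s \<in> J \<Longrightarrow> t \<in> J \<Longrightarrow> norm (z t - z s) \<le> M * \<bar>t - s\<bar>"
  shows "locally_abs_cont_on J z"
  unfolding locally_abs_cont_on_def abs_cont_on_interval_def
proof (intro allI impI)
  fix a b e :: real assume ab: "{a..b} \<subseteq> J" and "0 < e"
  define d where "d = e / (\<bar>M\<bar> + 1)"
  have d: "0 < d" using \<open>0 < e\<close> by (simp add: d_def add_nonneg_pos)
  show "\<exists>\<delta>>0. \<forall>P. finite P \<and> (\<forall>(s, t)\<in>P. a \<le> s \<and> s < t \<and> t \<le> b) \<and>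
      (\<forall>(s, t)\<in>P. \<forall>(s', t')\<in>P. (s, t) \<noteq> (s', t') \<longrightarrow> {s<..<t} \<inter> {s'<..<t'} = {}) \<and>
      (\<Sum>(s, t)\<in>P. t - s) < \<delta> \<longrightarrow> (\<Sum>(s, t)\<in>P. norm (z t - z s)) < e"
  proof (intro exI[of _ d] conjI allI impI d, elim conjE)
    fix P :: "(real \<times> real) set"
    assume P: "\<forall>(s, t)\<in>P. a \<le> s \<and> s < t \<and> t \<le> b" and len: "(\<Sum>(s, t)\<in>P. t - s) < d"
    have "(\<Sum>(s, t)\<in>P. norm (z t - z s)) \<le> (\<Sum>(s, t)\<in>P. (\<bar>M\<bar> + 1) * (t - s))"
    proof (rule sum_mono, clarify)
      fix s t assume "(s, t) \<in> P"
      then have st: "a \<le> s" "s < t" "t \<le> b" using P by auto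
      then have "s \<in> J" "t \<in> J" using ab by auto
      then have "norm (z t - z s) \<le> M * (t - s)" using lip[of s t] st by simp
      also have "\<dots> \<le> (\<bar>M\<bar> + 1) * (t - s)" using st by (intro mult_right_mono) auto
      finally show "norm (z t - z s) \<le> (\<bar>M\<bar> + 1) * (t - s)" .
    qed
    also have "\<dots> = (\<bar>M\<bar> + 1) * (\<Sum>(s, t)\<in>P. t - s)"
      by (simp add: sum_distrib_left case_prod_beta)
    also have "\<dots> < (\<bar>M\<bar> + 1) * d" using len by (intro mult_strict_left_mono) auto
    also have "\<dots> = e" by (simp add: d_def)
    finally show "(\<Sum>(s, t)\<in>P. norm (z t - z s)) < e" .
  qed
qed

text \<open>An interior point of J has a compact interval of J around it, where the assumed
  derivative is two-sided; the frontier of an interval is a null set. Stating the assumption on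
  compact subintervals covers the half-lines used for infinite horizons.\<close>

lemma has_ae_derivative_onI_Lipschitz:
  fixes z h :: "real \<Rightarrow> 'a::euclidean_space"
  assumes J: "J \<noteq> {}" "is_interval J"
    and lip: "\<And>s t. s \<in> J \<Longrightarrow> t \<in> J \<Longrightarrow> norm (z t - z s) \<le> M * \<bar>t - s\<bar>"
    and der: "\<And>a b t. a < b \<Longrightarrow> {a..b} \<subseteq> J \<Longrightarrow> t \<in> {a..b} \<Longrightarrow>
      (z has_vector_derivative h t) (at t within {a..b})"
  shows "has_ae_derivative_on J z h"
  unfolding has_ae_derivative_on_def
proof (intro conjI J Lipschitz_imp_locally_abs_cont_on)
  show "\<And>s t. s \<in> J \<Longrightarrow> t \<in> J \<Longrightarrow> norm (z t - z s) \<le> M * \<bar>t - s\<bar>" by (rule lip)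
  have "frontier J \<in> null_sets lebesgue"
    using negligible_convex_frontier[of J] J(2) by (simp add: is_interval_convex negligible_iff_null_sets)
  then have "AE t in lebesgue. t \<notin> frontier J" by (rule AE_not_in)
  then show "AE t in lebesgue. t \<in> J \<longrightarrow> (z has_vector_derivative h t) (at t within J)"
  proof (eventually_elim, intro impI)
    fix t assume "t \<notin> frontier J" "t \<in> J"
    then have "t \<in> interior J" using closure_subset by (auto simp: frontier_def)
    then obtain e where e: "e > 0" "cball t e \<subseteq> J"
      by (meson mem_interior_cball)
    then have "(z has_vector_derivative h t) (at t within {t - e..t + e})"
      by (intro der) (auto simp: cball_eq_atLeastAtMost)
    then have "(z has_vector_derivative h t) (at t)"
      using at_within_interior[of t "{t - e..t + e}"] e by simp
    then show "(z has_vector_derivative h t) (at t within J)"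
      by (rule has_vector_derivative_at_within)
  qed
qed

section \<open>Arcs of a trajectory in one mode\<close>

text \<open>The mode is only known on [p, q), since q may be the next jump. The state at q still
  lies in the domain of the old mode, as a limit of states in a closed set, so arcs may be treated
  as closed.\<close>

lemma trajectory_mode_arc:
  fixes Df :: "('a::euclidean_space \<times> 'g::metric_space) set"
  assumes Df: "closed Df" and tr: "trajectory Df f (I, x, \<sigma>)" "forward_complete (I, x, \<sigma>)"
    and pq: "0 \<le> p" and mode: "\<And>u. p \<le> u \<Longrightarrow> u < q \<Longrightarrow> \<sigma> u = \<gamma>"
  shows "p < q \<Longrightarrow> u \<in> {p..q} \<Longrightarrow> (x u, \<gamma>) \<in> Df"
    and "p \<le> s \<Longrightarrow> s \<le> t \<Longrightarrow> t \<le> q \<Longrightarrow> ((\<lambda>u. f (x u, \<gamma>)) has_integral (x t - x s)) {s..t}"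
proof -
  have I: "u \<in> I" if "p \<le> u" for u using that tr(2) pq by (auto simp: forward_complete_def)
  have inD: "(x u, \<gamma>) \<in> Df" if "p \<le> u" "u < q" for u
    using tr(1) I[of u] mode[OF that] that unfolding trajectory_def by fastforce
  show "(x u, \<gamma>) \<in> Df" if "p < q" "u \<in> {p..q}"
  proof (cases "u < q")
    case True
    then show ?thesis using inD that by auto
  next
    case False
    then have u: "u = q" using that by auto
    have "(x \<longlongrightarrow> x q) (at q within {p..q})"
      using trajectory_continuous_on[OF tr pq, of q] \<open>p < q\<close>
      by (auto simp: continuous_on_def)
    then have "(x \<longlongrightarrow> x q) (at q within {p..<q})" by (rule tendsto_within_subset) auto
    then have "((\<lambda>u. (x u, \<gamma>)) \<longlongrightarrow> (x q, \<gamma>)) (at q within {p..<q})" by (intro tendsto_intros)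
    moreover have "\<forall>\<^sub>F u in at q within {p..<q}. (x u, \<gamma>) \<in> Df"
      using inD by (auto simp: eventually_at_filter)
    moreover have "at q within {p..<q} = at_left q"
      by (rule at_within_nhd[of _ "{p<..}"]) (use \<open>p < q\<close> in auto)
    ultimately show ?thesis
      unfolding u using Lim_in_closed_set[OF Df] trivial_limit_at_left_real by metis
  qed
  show "((\<lambda>u. f (x u, \<gamma>)) has_integral (x t - x s)) {s..t}" if st: "p \<le> s" "s \<le> t" "t \<le> q"
  proof -
    have sub: "{s..t} \<subseteq> I" using I st by auto
    have ae: "AE u in lebesgue. u \<in> I \<longrightarrow> (x has_vector_derivative f (x u, \<sigma> u)) (at u within I)"
      and ac: "abs_cont_on_interval s t x"
      using tr(1) sub by (auto simp: trajectory_def has_ae_derivative_on_def locally_abs_cont_on_def)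
    obtain N where N: "N \<in> null_sets lebesgue"
      "{u \<in> space lebesgue. \<not> (u \<in> I \<longrightarrow> (x has_vector_derivative f (x u, \<sigma> u)) (at u within I))} \<subseteq> N"
      using ae unfolding eventually_ae_filter by blast
    \<comment> \<open>At q the signal may already have switched, so q joins the exceptional null
      set.\<close>
    have "negligible (insert q N)" using N(1) by (simp add: negligible_iff_null_sets negligible_insert)
    then show ?thesis
    proof (rule fundamental_theorem_of_calculus_abs_cont[OF st(2) ac])
      fix u assume u: "u \<in> {s..t} - insert q N"
      then have "(x has_vector_derivative f (x u, \<sigma> u)) (at u within I)" using N(2) sub by auto
      moreover have "\<sigma> u = \<gamma>" using mode[of u] u st by auto
      ultimately show "(x has_vector_derivative f (x u, \<gamma>)) (at u within {s..t})"
        using sub by (auto intro: has_vector_derivative_within_subset)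
    qed
  qed
qed

text \<open>The chain rule is applied within {a..b}, so the ends of an arc are included; a < b makes
  the derivative of the composition unique and therefore 0.\<close>

lemma constant_along_solution_imp_derivative_zero:
  fixes z :: "real \<Rightarrow> 'a::euclidean_space" and v :: "'a \<Rightarrow> real"
  assumes "a < b" "t \<in> {a..b}"
    and z: "(z has_vector_derivative w) (at t within {a..b})"
    and v: "v differentiable (at (z t))"
    and const: "\<And>u. u \<in> {a..b} \<Longrightarrow> v (z u) = c"
  shows "frechet_derivative v (at (z t)) w = 0"
proof -
  have "(v has_derivative frechet_derivative v (at (z t))) (at (z t))"
    using v frechet_derivative_works by blast
  then have "(v has_derivative frechet_derivative v (at (z t))) (at (z t) within z ` {a..b})"
    by (rule has_derivative_at_withinI)
  from diff_chain_within[OF z[unfolded has_vector_derivative_def] this]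
  have "(v \<circ> z has_derivative (\<lambda>h. frechet_derivative v (at (z t)) (h *\<^sub>R w))) (at t within {a..b})"
    by (simp add: o_def)
  moreover have "linear (frechet_derivative v (at (z t)))"
    using v by (rule linear_frechet_derivative)
  ultimately have "(v \<circ> z has_vector_derivative frechet_derivative v (at (z t)) w) (at t within cbox a b)"
    by (simp add: has_vector_derivative_def linear_cmul)
  moreover have "(v \<circ> z has_vector_derivative 0) (at t within cbox a b)"
    by (rule has_vector_derivative_transform[OF _ _ has_vector_derivative_const[of c]])
      (use assms(2) const in auto)
  ultimately show ?thesis
    by (rule vector_derivative_unique_within_closed_interval[rotated 2]) (use assms(1,2) in auto)
qed

text \<open>Time is measured from s k, so that arcs at different times become comparable. Windows
  [a k, b k] that may vary with k let one statement serve both arcs of fixed length next to a jump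
  and arcs growing to the whole line. Compactness comes from the bound R together with closedness of
  the slice of \<open>Df\<close>.\<close>

lemma late_mode_arcs_limit_solution:
  fixes Df :: "('a::euclidean_space \<times> 'g::metric_space) set" and s :: "nat \<Rightarrow> real"
  assumes Df: "closed Df" "continuous_on Df f"
    and tr: "trajectory Df f (I, x, \<sigma>)" "forward_complete (I, x, \<sigma>)"
    and R: "cball 0 R \<subseteq> base DV" "\<And>t. 0 \<le> t \<Longrightarrow> norm (x t) \<le> R"
    and arcs: "\<And>k. 0 \<le> s k + a k" "\<And>k. a k < b k"
      "\<And>k t. a k \<le> t \<Longrightarrow> t < b k \<Longrightarrow> \<sigma> (s k + t) = \<gamma>"
    and J: "\<And>t. t \<in> J \<Longrightarrow> \<forall>\<^sub>F k in sequentially. t \<in> {a k..b k}"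
  obtains r z M where "strict_mono (r :: nat \<Rightarrow> nat)"
    "\<And>t. t \<in> J \<Longrightarrow> (\<lambda>k. x (s (r k) + t)) \<longlonglongrightarrow> z t"
    "\<And>t. t \<in> J \<Longrightarrow> z t \<in> mode_base Df DV \<gamma>"
    "\<bar>M\<bar>-lipschitz_on J z"
    "\<And>p q t. {p..q} \<subseteq> J \<Longrightarrow> t \<in> {p..q} \<Longrightarrow>
      (z has_vector_derivative f (z t, \<gamma>)) (at t within {p..q})"
proof -
  define K where "K = cball 0 R \<inter> slice Df \<gamma>"
  have slice: "slice Df \<gamma> = (\<lambda>\<xi>. (\<xi>, \<gamma>)) -` Df" by (auto simp: slice_def)
  have "closed (slice Df \<gamma>)"
    unfolding slice by (intro continuous_closed_vimage Df(1)) auto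
  then have K: "compact K" by (auto simp: K_def)
  have g: "continuous_on K (\<lambda>\<xi>. f (\<xi>, \<gamma>))"
    by (rule continuous_on_compose2[OF Df(2)]) (auto simp: K_def slice_def intro!: continuous_intros)
  have KB: "K \<subseteq> mode_base Df DV \<gamma>" using R(1) by (auto simp: K_def mode_base_def)
  have mode: "\<sigma> u = \<gamma>" if "s k + a k \<le> u" "u < s k + b k" for k u
    using arcs(3)[of k "u - s k"] that by auto
  obtain r z M where r: "strict_mono (r :: nat \<Rightarrow> nat)"
    and z: "\<And>t. t \<in> J \<Longrightarrow> (\<lambda>k. x (s (r k) + t)) \<longlonglongrightarrow> z t" "\<And>t. t \<in> J \<Longrightarrow> z t \<in> K"
    and lip: "\<And>s t. s \<in> J \<Longrightarrow> t \<in> J \<Longrightarrow> norm (z t - z s) \<le> M * \<bar>t - s\<bar>"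
    and int: "\<And>s t. s \<le> t \<Longrightarrow> {s..t} \<subseteq> J \<Longrightarrow> ((\<lambda>u. f (z u, \<gamma>)) has_integral (z t - z s)) {s..t}"
  proof (rule limit_solution[OF K g, of "\<lambda>k. {a k..b k}" J "\<lambda>k t. x (s k + t)"])
    show "is_interval {a k..b k}" for k by (rule is_interval_cc)
    show "\<forall>\<^sub>F k in sequentially. t \<in> {a k..b k}" if "t \<in> J" for t by (rule J[OF that])
    show "x (s k + t) \<in> K" if "t \<in> {a k..b k}" for k t
    proof -
      have "(x (s k + t), \<gamma>) \<in> Df"
        by (rule trajectory_mode_arc(1)[where p = "s k + a k" and q = "s k + b k", OF Df(1) tr arcs(1)])
          (use arcs(2) mode that in auto)
      moreover have "0 \<le> s k + t" using arcs(1)[of k] that by auto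
      ultimately show ?thesis using R(2) by (auto simp: K_def slice_def)
    qed
    show "((\<lambda>u. f (x (s k + u), \<gamma>)) has_integral x (s k + t') - x (s k + t)) {t..t'}"
      if "t \<in> {a k..b k}" "t' \<in> {a k..b k}" "t \<le> t'" for k t t'
    proof -
      have "((\<lambda>u. f (x u, \<gamma>)) has_integral x (s k + t') - x (s k + t)) {s k + t..s k + t'}"
        by (rule trajectory_mode_arc(2)[where p = "s k + a k" and q = "s k + b k", OF Df(1) tr arcs(1)])
          (use mode that in auto)
      from has_integral_shift_real_ivl[OF this, of "s k"] show ?thesis by (simp add: add.commute)
    qed
  qed blast
  have zL: "\<bar>M\<bar>-lipschitz_on J z"
  proof (rule lipschitz_onI)
    fix t t' assume "t \<in> J" "t' \<in> J"
    then have "dist (z t) (z t') \<le> M * dist t t'" using lip[of t' t] by (simp add: dist_norm dist_real_def)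
    also have "\<dots> \<le> \<bar>M\<bar> * dist t t'" by (rule mult_right_mono) auto
    finally show "dist (z t) (z t') \<le> \<bar>M\<bar> * dist t t'" .
  qed simp
  then have zc: "continuous_on J z" by (rule lipschitz_on_continuous_on)
  have der: "(z has_vector_derivative f (z t, \<gamma>)) (at t within {p..q})"
    if "{p..q} \<subseteq> J" "t \<in> {p..q}" for p q t
  proof (rule integral_equation_has_vector_derivative[OF _ _ that(2)])
    show "((\<lambda>u. f (z u, \<gamma>)) has_integral z v - z p) {p..v}" if "v \<in> {p..q}" for v
      using that \<open>{p..q} \<subseteq> J\<close> by (intro int) auto
    show "continuous_on {p..q} (\<lambda>u. f (z u, \<gamma>))"
      using that z(2) by (intro continuous_on_compose2[OF g] continuous_on_subset[OF zc]) auto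
  qed
  show thesis
  proof (rule that[OF r z(1) _ zL der])
    show "z t \<in> mode_base Df DV \<gamma>" if "t \<in> J" for t using z(2)[OF that] KB by blast
  qed
qed

text \<open>\<open>V\<^sub>\<gamma>\<close> is constant along such a limit, which forces \<open>W\<^sub>\<gamma> = 0\<close> although nothing is known about
  the continuity of \<open>W\<close>.\<close>

lemma late_mode_arcs_limit:
  fixes Df :: "('a::euclidean_space \<times> 'g::metric_space) set" and V W :: "'a \<times> 'g \<Rightarrow> real"
    and s :: "nat \<Rightarrow> real"
  assumes Df: "closed Df" "continuous_on Df f"
    and tr: "trajectory Df f (I, x, \<sigma>)" "forward_complete (I, x, \<sigma>)"
    and V: "class_V Df DV V"
    and diss: "\<And>\<xi>. \<xi> \<in> mode_base Df DV \<gamma> \<Longrightarrow>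
      - frechet_derivative (\<lambda>\<zeta>. V (\<zeta>, \<gamma>)) (at \<xi>) (f (\<xi>, \<gamma>)) \<ge> W (\<xi>, \<gamma>) \<and> W (\<xi>, \<gamma>) \<ge> 0"
    and R: "cball 0 R \<subseteq> base DV" "\<And>t. 0 \<le> t \<Longrightarrow> norm (x t) \<le> R"
    and s: "filterlim s at_top sequentially"
    and arcs: "\<And>k. 0 \<le> s k + a k" "\<And>k. a k < b k"
      "\<And>k t. a k \<le> t \<Longrightarrow> t < b k \<Longrightarrow> \<sigma> (s k + t) = \<gamma>"
    and J: "is_interval J" "u\<^sub>0 \<in> J" "v\<^sub>0 \<in> J" "u\<^sub>0 < v\<^sub>0"
      "\<And>t. t \<in> J \<Longrightarrow> \<forall>\<^sub>F k in sequentially. t \<in> {a k..b k}"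
    and lim: "((\<lambda>t. V (x t, \<gamma>)) \<longlongrightarrow> c) (inf at_top (principal (\<sigma> -` {\<gamma>})))"
  obtains r z where "strict_mono (r :: nat \<Rightarrow> nat)"
    "\<And>t. t \<in> J \<Longrightarrow> (\<lambda>k. x (s (r k) + t)) \<longlonglongrightarrow> z t"
    "\<And>t. t \<in> J \<Longrightarrow> z t \<in> mode_base Df DV \<gamma> \<and> V (z t, \<gamma>) = c \<and> W (z t, \<gamma>) = 0"
    "\<And>J'. J' \<noteq> {} \<Longrightarrow> is_interval J' \<Longrightarrow> J' \<subseteq> J \<Longrightarrow> has_ae_derivative_on J' z (\<lambda>t. f (z t, \<gamma>))"
proof -
  obtain r z M where r: "strict_mono (r :: nat \<Rightarrow> nat)"
    and z: "\<And>t. t \<in> J \<Longrightarrow> (\<lambda>k. x (s (r k) + t)) \<longlonglongrightarrow> z t" "\<And>t. t \<in> J \<Longrightarrow> z t \<in> mode_base Df DV \<gamma>"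
    and zL: "\<bar>M\<bar>-lipschitz_on J z"
    and der: "\<And>p q t. {p..q} \<subseteq> J \<Longrightarrow> t \<in> {p..q} \<Longrightarrow>
      (z has_vector_derivative f (z t, \<gamma>)) (at t within {p..q})"
    using late_mode_arcs_limit_solution[OF Df tr R arcs J(5)] by metis
  have zc: "continuous_on J z" using zL by (rule lipschitz_on_continuous_on)
  have Vd: "(\<lambda>\<zeta>. V (\<zeta>, \<gamma>)) differentiable (at (z t))" if "t \<in> J" for t
    using V z(2)[OF that] by (auto simp: class_V_def)
  \<comment> \<open>The mode is known only before b k. A later point q of J guarantees t < b k
    eventually, so the limit of V along mode \<gamma> can be used at t. A right end of J is treated
    afterwards, by continuity of V and z.\<close>
  have Vc_left: "V (z t, \<gamma>) = c" if t: "t \<in> J" "q \<in> J" "t < q" for t q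
  proof -
    have "filterlim (\<lambda>k. t + s (r k)) at_top sequentially"
      by (intro filterlim_tendsto_add_at_top[OF tendsto_const] filterlim_compose[OF s] filterlim_subseq r)
    then have "filterlim (\<lambda>k. s (r k) + t) at_top sequentially" by (simp add: add.commute)
    moreover have "\<forall>\<^sub>F k in sequentially. s (r k) + t \<in> \<sigma> -` {\<gamma>}"
      using eventually_subseq[OF r J(5)[OF t(1)]] eventually_subseq[OF r J(5)[OF t(2)]]
      by eventually_elim (use arcs(3) t(3) in auto)
    ultimately have "filterlim (\<lambda>k. s (r k) + t) (inf at_top (principal (\<sigma> -` {\<gamma>}))) sequentially"
      by (simp add: filterlim_inf filterlim_principal)
    from filterlim_compose[OF lim this]
    have "(\<lambda>k. V (x (s (r k) + t), \<gamma>)) \<longlonglongrightarrow> c" .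
    moreover have "(\<lambda>k. V (x (s (r k) + t), \<gamma>)) \<longlonglongrightarrow> V (z t, \<gamma>)"
      using isCont_tendsto_compose[OF differentiable_imp_continuous_within[OF Vd[OF t(1)]] z(1)[OF t(1)]] .
    ultimately show ?thesis using LIMSEQ_unique by blast
  qed
  \<comment> \<open>Even an endpoint of J lies in a nondegenerate compact subinterval, as uniqueness
    of the derivative requires.\<close>
  have around: "\<exists>p q. p < q \<and> {p..q} \<subseteq> J \<and> t \<in> {p..q}" if t: "t \<in> J" for t
  proof -
    have *: "{min t w..max t w} \<subseteq> J" if "w \<in> J" for w
    proof
      fix u assume "u \<in> {min t w..max t w}"
      then have "(t \<le> u \<and> u \<le> w) \<or> (w \<le> u \<and> u \<le> t)" by auto
      then show "u \<in> J" using mem_is_interval_1_I[OF J(1)] t that by blast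
    qed
    obtain w where "w \<in> J" "w \<noteq> t" using J(2-4) by (metis less_irrefl)
    then show ?thesis using *[of w] by (intro exI[of _ "min t w"] exI[of _ "max t w"]) auto
  qed
  have Vc: "V (z t, \<gamma>) = c" if t: "t \<in> J" for t
  proof (cases "\<exists>q\<in>J. t < q")
    case True
    then show ?thesis using Vc_left t by blast
  next
    case False
    obtain p q where pq: "p < q" "{p..q} \<subseteq> J" "t \<in> {p..q}" using around[OF t] by blast
    moreover have "q \<in> J" using pq by auto
    ultimately have "q = t" using False by (metis atLeastAtMost_iff order_le_less)
    with pq have "p < t" "{p..t} \<subseteq> J" by auto
    have "(z \<longlongrightarrow> z t) (at t within {p..<t})"
      using zc[unfolded continuous_on_def, rule_format, OF t]
      by (rule tendsto_within_subset) (use \<open>{p..t} \<subseteq> J\<close> in auto)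
    then have "((\<lambda>u. V (z u, \<gamma>)) \<longlongrightarrow> V (z t, \<gamma>)) (at t within {p..<t})"
      by (rule isCont_tendsto_compose[OF differentiable_imp_continuous_within[OF Vd[OF t]]])
    moreover have "V (z u, \<gamma>) = c" if "u \<in> {p..<t}" for u
      by (rule Vc_left[OF _ t]) (use \<open>{p..t} \<subseteq> J\<close> that in \<open>auto simp: subset_eq\<close>)
    then have "\<forall>\<^sub>F u in at t within {p..<t}. V (z u, \<gamma>) = c"
      by (auto simp: eventually_at_filter intro!: always_eventually)
    then have "((\<lambda>u. V (z u, \<gamma>)) \<longlongrightarrow> c) (at t within {p..<t})" by (rule tendsto_eventually)
    moreover have "at t within {p..<t} = at_left t"
      by (rule at_within_nhd[of _ "{p<..}"]) (use \<open>p < t\<close> in auto)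
    ultimately show ?thesis using tendsto_unique[OF trivial_limit_at_left_real] by metis
  qed
  have W0: "W (z t, \<gamma>) = 0" if t: "t \<in> J" for t
  proof -
    obtain p q where pq: "p < q" "{p..q} \<subseteq> J" "t \<in> {p..q}" using around[OF t] by blast
    have "frechet_derivative (\<lambda>\<zeta>. V (\<zeta>, \<gamma>)) (at (z t)) (f (z t, \<gamma>)) = 0"
      by (rule constant_along_solution_imp_derivative_zero[OF pq(1,3) der[OF pq(2,3)] Vd[OF t]])
        (use Vc pq(2) in auto)
    then show ?thesis using diss[of "z t"] z(2)[OF t] by force
  qed
  show thesis
  proof (rule that[OF r z(1)])
    show "z t \<in> mode_base Df DV \<gamma> \<and> V (z t, \<gamma>) = c \<and> W (z t, \<gamma>) = 0" if "t \<in> J" for t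
      using z(2)[OF that] Vc[OF that] W0[OF that] by blast
    show "has_ae_derivative_on J' z (\<lambda>t. f (z t, \<gamma>))" if "J' \<noteq> {}" "is_interval J'" "J' \<subseteq> J" for J'
    proof (rule has_ae_derivative_onI_Lipschitz[OF that(1,2)])
      show "norm (z t - z s) \<le> \<bar>M\<bar> * \<bar>t - s\<bar>" if "s \<in> J'" "t \<in> J'" for s t
        using lipschitz_onD[OF zL, of t s] that \<open>J' \<subseteq> J\<close> by (auto simp: dist_norm dist_real_def)
      show "(z has_vector_derivative f (z t, \<gamma>)) (at t within {p..q})"
        if "p < q" "{p..q} \<subseteq> J'" "t \<in> {p..q}" for p q t
        using der that \<open>J' \<subseteq> J\<close> by blast
    qed
  qed
qed

subsection \<open>Recurrence near zero\<close>

text \<open>The filter lets t tend to infinity through S only. For a mode that ceases to be active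
  it is trivial and any limit will do, so a level exists for every mode; otherwise the level is the
  infimum over the nonnegative times of S.\<close>

lemma antimono_nonneg_convergent_along:
  fixes h :: "real \<Rightarrow> real"
  assumes anti: "\<And>s t. 0 \<le> s \<Longrightarrow> s \<le> t \<Longrightarrow> s \<in> S \<Longrightarrow> t \<in> S \<Longrightarrow> h t \<le> h s"
    and nonneg: "\<And>t. 0 \<le> t \<Longrightarrow> t \<in> S \<Longrightarrow> 0 \<le> h t"
  obtains c where "(h \<longlongrightarrow> c) (inf at_top (principal S))"
proof (cases "S \<inter> {0..} = {}")
  case True
  have "\<forall>\<^sub>F t in at_top. t \<in> S \<longrightarrow> P t" for P
    using eventually_ge_at_top[of 0] by eventually_elim (use True in auto)
  then have "(h \<longlongrightarrow> 0) (inf at_top (principal S))"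
    by (auto simp: tendsto_iff eventually_inf_principal)
  then show thesis using that by blast
next
  case False
  define A where "A = h ` (S \<inter> {0..})"
  have A: "A \<noteq> {}" "bdd_below A"
    using False nonneg by (auto simp: A_def bdd_below_def)
  have "\<forall>\<^sub>F t in inf at_top (principal S). dist (h t) (Inf A) < e" if e: "0 < e" for e
  proof -
    obtain t\<^sub>0 where t0: "0 \<le> t\<^sub>0" "t\<^sub>0 \<in> S" "h t\<^sub>0 < Inf A + e"
      using cInf_lessD[OF A(1), of "Inf A + e"] e by (auto simp: A_def)
    have "dist (h t) (Inf A) < e" if "t\<^sub>0 \<le> t" "t \<in> S" for t
    proof -
      have "h t \<in> A" using t0 that by (auto simp: A_def)
      then have "Inf A \<le> h t" using A(2) by (rule cInf_lower)
      moreover have "h t \<le> h t\<^sub>0" using anti t0 that by blast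
      ultimately show ?thesis using t0(3) by (simp add: dist_real_def)
    qed
    then show ?thesis
      unfolding eventually_inf_principal eventually_at_top_linorder by blast
  qed
  then have "(h \<longlongrightarrow> Inf A) (inf at_top (principal S))" by (rule tendstoI)
  then show thesis using that by blast
qed

text \<open>One limit curve on the whole line restricts to both half-lines, so its state at time 0
  lies in both observability sets and either alternative of (i) applies to it.\<close>

lemma finally_constant_signal_limit:
  fixes Df :: "('a::euclidean_space \<times> 'g::metric_space) set" and V W :: "'a \<times> 'g \<Rightarrow> real"
  assumes Df: "closed Df" "continuous_on Df f"
    and tr: "trajectory Df f (I, x, \<sigma>)" "forward_complete (I, x, \<sigma>)"
    and V: "class_V Df DV V"
    and diss: "\<And>\<xi> \<gamma>. \<xi> \<in> mode_base Df DV \<gamma> \<Longrightarrow>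
      - frechet_derivative (\<lambda>\<zeta>. V (\<zeta>, \<gamma>)) (at \<xi>) (f (\<xi>, \<gamma>)) \<ge> W (\<xi>, \<gamma>) \<and> W (\<xi>, \<gamma>) \<ge> 0"
    and R: "cball 0 R \<subseteq> base DV" "\<And>t. 0 \<le> t \<Longrightarrow> norm (x t) \<le> R"
    and lim: "\<And>\<gamma>. ((\<lambda>t. V (x t, \<gamma>)) \<longlongrightarrow> c \<gamma>) (inf at_top (principal (\<sigma> -` {\<gamma>})))"
    and T\<^sub>0: "\<And>t. T\<^sub>0 \<le> t \<Longrightarrow> t \<notin> jump_times \<sigma>"
  obtains \<gamma> \<xi> s where "filterlim s at_top sequentially" "(\<lambda>k::nat. x (s k)) \<longlonglongrightarrow> \<xi>"
    "\<xi> \<in> O_fwd_inf Df f DV W \<gamma>" "\<xi> \<in> O_bwd_inf Df f DV W \<gamma>"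
proof -
  have sw: "switching_signal \<sigma>" using tr(1) by (simp add: trajectory_def)
  define T\<^sub>1 where "T\<^sub>1 = max 0 T\<^sub>0"
  define \<gamma> where "\<gamma> = \<sigma> T\<^sub>1"
  have mode: "\<sigma> u = \<gamma>" if "T\<^sub>1 \<le> u" for u
  proof -
    have "jump_times \<sigma> \<inter> {T\<^sub>1..u} = {}" using T\<^sub>0 by (auto simp: T\<^sub>1_def)
    then show ?thesis using sw that by (auto simp: switching_signal_def \<gamma>_def)
  qed
  \<comment> \<open>The window [-k, k + 1] around s k begins exactly at \<open>T\<^sub>1\<close> and
    thus stays in mode \<gamma>. The windows exhaust the line, and the + 1 keeps the one for k = 0
    nondegenerate.\<close>
  define s where "s k = T\<^sub>1 + real k" for k :: nat
  have s: "filterlim s at_top sequentially"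
    unfolding s_def by (intro filterlim_tendsto_add_at_top[OF tendsto_const] filterlim_real_sequentially)
  obtain r z where r: "strict_mono (r :: nat \<Rightarrow> nat)"
    and z: "\<And>t. t \<in> UNIV \<Longrightarrow> (\<lambda>k. x (s (r k) + t)) \<longlonglongrightarrow> z t"
      "\<And>t. t \<in> UNIV \<Longrightarrow> z t \<in> mode_base Df DV \<gamma> \<and> V (z t, \<gamma>) = c \<gamma> \<and> W (z t, \<gamma>) = 0"
      "\<And>J'. J' \<noteq> {} \<Longrightarrow> is_interval J' \<Longrightarrow> J' \<subseteq> UNIV \<Longrightarrow> has_ae_derivative_on J' z (\<lambda>t. f (z t, \<gamma>))"
  proof (rule late_mode_arcs_limit[OF Df tr V diss R s, of \<gamma> "\<lambda>k. - real k" "\<lambda>k. real k + 1" UNIV 0 1 "c \<gamma>"])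
    show "0 \<le> s k + - real k" for k by (simp add: s_def T\<^sub>1_def)
    show "\<sigma> (s k + t) = \<gamma>" if "- real k \<le> t" for k t using that by (intro mode) (simp add: s_def)
    show "\<forall>\<^sub>F k in sequentially. t \<in> {- real k..real k + 1}" for t
    proof -
      obtain N :: nat where "\<bar>t\<bar> \<le> real N" using real_arch_simple by blast
      then show ?thesis by (intro eventually_sequentiallyI[of N]) (auto simp: abs_le_iff)
    qed
    show "((\<lambda>t. V (x t, \<gamma>)) \<longlongrightarrow> c \<gamma>) (inf at_top (principal (\<sigma> -` {\<gamma>})))" by (rule lim)
  qed auto
  have "z 0 \<in> O_fwd_inf Df f DV W \<gamma>"
  proof -
    have iv: "{t. 0 \<le> t \<and> ereal t \<le> \<infinity>} = {0..}" by auto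
    show ?thesis
      unfolding O_fwd_inf_def obs_fwd_upto_def iv
      using z(2) z(3)[of "{0..}"] by (auto simp: is_interval_ci intro!: exI[of _ z])
  qed
  moreover have "z 0 \<in> O_bwd_inf Df f DV W \<gamma>"
  proof -
    have iv: "{t. - \<infinity> \<le> ereal t \<and> t \<le> 0} = {..0}" by auto
    show ?thesis
      unfolding O_bwd_inf_def obs_bwd_upto_def iv
      using z(2) z(3)[of "{..0}"] by (auto simp: is_interval_ic intro!: exI[of _ z])
  qed
  moreover have "(\<lambda>k. x (s (r k))) \<longlonglongrightarrow> z 0" using z(1)[of 0] by simp
  ultimately show thesis
    using that[OF filterlim_compose[OF s filterlim_subseq[OF r]]] by blast
qed

text \<open>The arcs before and after the same late jumps share the state at the jump, hence so do
  their limits. That shared state ends a solution in the old mode and starts one in the new mode,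
  each on its own level.\<close>

lemma recurrent_transition_limit:
  fixes Df :: "('a::euclidean_space \<times> 'g::metric_space) set" and V W :: "'a \<times> 'g \<Rightarrow> real"
  assumes fin: "finite (UNIV :: 'g set)" and Df: "closed Df" "continuous_on Df f"
    and tr: "trajectory Df f (I, x, \<sigma>)" "forward_complete (I, x, \<sigma>)"
    and \<sigma>: "\<sigma> \<in> signals_d"
    and V: "class_V Df DV V"
    and diss: "\<And>\<xi> \<gamma>. \<xi> \<in> mode_base Df DV \<gamma> \<Longrightarrow>
      - frechet_derivative (\<lambda>\<zeta>. V (\<zeta>, \<gamma>)) (at \<xi>) (f (\<xi>, \<gamma>)) \<ge> W (\<xi>, \<gamma>) \<and> W (\<xi>, \<gamma>) \<ge> 0"
    and R: "cball 0 R \<subseteq> base DV" "\<And>t. 0 \<le> t \<Longrightarrow> norm (x t) \<le> R"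
    and lim: "\<And>\<gamma>. ((\<lambda>t. V (x t, \<gamma>)) \<longlongrightarrow> c \<gamma>) (inf at_top (principal (\<sigma> -` {\<gamma>})))"
    and Eg: "recurrent_transition \<sigma> \<gamma> \<gamma>'"
  obtains \<xi> s where "filterlim s at_top sequentially" "(\<lambda>k::nat. x (s k)) \<longlonglongrightarrow> \<xi>"
    "\<xi> \<in> O_bwd Df f DV W \<gamma> \<inter> O_fwd Df f DV W \<gamma>' \<inter> level_set DV V \<gamma> (c \<gamma>) \<inter> level_set DV V \<gamma>' (c \<gamma>')"
proof -
  have sw: "switching_signal \<sigma>" using tr(1) by (simp add: trajectory_def)
  obtain \<tau> where \<tau>: "0 < \<tau>"
    and gap_left: "\<And>t. t \<in> jump_times \<sigma> \<Longrightarrow> jump_times \<sigma> \<inter> {t - \<tau><..<t} = {}"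
    and gap_right: "\<And>t. t \<in> jump_times \<sigma> \<Longrightarrow> jump_times \<sigma> \<inter> {t<..<t + \<tau>} = {}"
    and left: "\<And>t. t \<in> jump_times \<sigma> \<Longrightarrow> Lim (at_left t) \<sigma> = \<sigma> (t - \<tau>)"
    using signals_d_gap[OF fin \<sigma>] by metis
  \<comment> \<open>The offset \<tau> keeps the window before each chosen jump at nonnegative times;
    the bound k sends the jumps to infinity.\<close>
  have "\<forall>k::nat. \<exists>t\<ge>real k + \<tau>. t \<in> jump_times \<sigma> \<and> Lim (at_left t) \<sigma> = \<gamma> \<and> \<sigma> t = \<gamma>'"
    using Eg unfolding recurrent_transition_def frequently_at_top_real by blast
  then obtain s where s: "\<And>k::nat. real k + \<tau> \<le> s k" "\<And>k. s k \<in> jump_times \<sigma>"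
    "\<And>k. Lim (at_left (s k)) \<sigma> = \<gamma>" "\<And>k. \<sigma> (s k) = \<gamma>'" by metis
  have sk: "real k \<le> s k" for k using s(1)[of k] \<tau> by linarith
  have s_top: "filterlim s at_top sequentially"
    by (rule filterlim_at_top_mono[OF filterlim_real_sequentially]) (use sk in auto)
  have before: "\<sigma> (s k + t) = \<gamma>" if "- \<tau> \<le> t" "t < 0" for k t
    using switching_signal_const_between[OF fin sw gap_left[OF s(2)[of k]], of "s k + t"]
      left[OF s(2)[of k]] s(3)[of k] that by simp
  have after: "\<sigma> (s k + t) = \<gamma>'" if "0 \<le> t" "t < \<tau>" for k t
    using switching_signal_const_between[OF fin sw gap_right[OF s(2)[of k]], of "s k + t"]
      s(4)[of k] that by simp
  have s_nonneg: "0 \<le> s k" "0 \<le> s k + - \<tau>" for k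
    using s(1)[of k] \<tau> of_nat_0_le_iff[of k] by linarith+
  obtain r z where r: "strict_mono (r :: nat \<Rightarrow> nat)"
    and z: "\<And>t. t \<in> {-\<tau>..0} \<Longrightarrow> (\<lambda>k. x (s (r k) + t)) \<longlonglongrightarrow> z t"
      "\<And>t. t \<in> {-\<tau>..0} \<Longrightarrow> z t \<in> mode_base Df DV \<gamma> \<and> V (z t, \<gamma>) = c \<gamma> \<and> W (z t, \<gamma>) = 0"
      "\<And>J'. J' \<noteq> {} \<Longrightarrow> is_interval J' \<Longrightarrow> J' \<subseteq> {-\<tau>..0} \<Longrightarrow> has_ae_derivative_on J' z (\<lambda>t. f (z t, \<gamma>))"
  proof (rule late_mode_arcs_limit[OF Df tr V diss R s_top, of \<gamma> "\<lambda>_. -\<tau>" "\<lambda>_. 0" "{-\<tau>..0}" "-\<tau>" 0 "c \<gamma>"])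
    show "0 \<le> s k + - \<tau>" for k by (rule s_nonneg(2))
    show "- \<tau> < 0" for k :: nat using \<tau> by simp
    show "\<sigma> (s k + t) = \<gamma>" if "- \<tau> \<le> t" "t < 0" for k t by (rule before[OF that])
    show "is_interval {-\<tau>..0}" by (rule is_interval_cc)
    show "- \<tau> \<in> {-\<tau>..0}" "0 \<in> {-\<tau>..0}" "- \<tau> < 0" using \<tau> by simp+
    show "\<forall>\<^sub>F k in sequentially. t \<in> {-\<tau>..0}" if "t \<in> {-\<tau>..0}" for t using that by simp
    show "((\<lambda>t. V (x t, \<gamma>)) \<longlongrightarrow> c \<gamma>) (inf at_top (principal (\<sigma> -` {\<gamma>})))" by (rule lim)
  qed (assumption | rule that)+
  have sr_top: "filterlim (\<lambda>k. s (r k)) at_top sequentially"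
    by (rule filterlim_compose[OF s_top filterlim_subseq[OF r]])
  \<comment> \<open>The second limit is extracted from the subsequence of the first, so both curves
    are limits along the same jumps and must agree at time 0.\<close>
  obtain r' z' where r': "strict_mono (r' :: nat \<Rightarrow> nat)"
    and z': "\<And>t. t \<in> {0..\<tau>} \<Longrightarrow> (\<lambda>k. x (s (r (r' k)) + t)) \<longlonglongrightarrow> z' t"
      "\<And>t. t \<in> {0..\<tau>} \<Longrightarrow> z' t \<in> mode_base Df DV \<gamma>' \<and> V (z' t, \<gamma>') = c \<gamma>' \<and> W (z' t, \<gamma>') = 0"
      "\<And>J'. J' \<noteq> {} \<Longrightarrow> is_interval J' \<Longrightarrow> J' \<subseteq> {0..\<tau>} \<Longrightarrow> has_ae_derivative_on J' z' (\<lambda>t. f (z' t, \<gamma>'))"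
  proof (rule late_mode_arcs_limit[OF Df tr V diss R sr_top, of \<gamma>' "\<lambda>_. 0" "\<lambda>_. \<tau>" "{0..\<tau>}" 0 \<tau> "c \<gamma>'"])
    show "0 \<le> s (r k) + 0" for k using s_nonneg(1) by simp
    show "0 < \<tau>" for k :: nat by (rule \<tau>)
    show "\<sigma> (s (r k) + t) = \<gamma>'" if "0 \<le> t" "t < \<tau>" for k t by (rule after[OF that])
    show "is_interval {0..\<tau>}" by (rule is_interval_cc)
    show "0 \<in> {0..\<tau>}" "\<tau> \<in> {0..\<tau>}" "0 < \<tau>" using \<tau> by simp+
    show "\<forall>\<^sub>F k in sequentially. t \<in> {0..\<tau>}" if "t \<in> {0..\<tau>}" for t using that by simp
    show "((\<lambda>t. V (x t, \<gamma>')) \<longlongrightarrow> c \<gamma>') (inf at_top (principal (\<sigma> -` {\<gamma>'})))" by (rule lim)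
  qed (assumption | rule that)+
  have "(\<lambda>k. x (s (r k))) \<longlonglongrightarrow> z 0" using z(1)[of 0] \<tau> by simp
  from LIMSEQ_subseq_LIMSEQ[OF this r'] have "(\<lambda>k. x (s (r (r' k)))) \<longlonglongrightarrow> z 0" by (simp add: o_def)
  moreover have "(\<lambda>k. x (s (r (r' k)))) \<longlonglongrightarrow> z' 0" using z'(1)[of 0] \<tau> by simp
  ultimately have eq: "z' 0 = z 0" by (rule LIMSEQ_unique[symmetric])
  have "z 0 \<in> O_bwd Df f DV W \<gamma>"
  proof -
    have iv: "{t. - ereal \<tau> \<le> ereal t \<and> t \<le> 0} = {-\<tau>..0}" by auto
    have "z 0 \<in> obs_bwd_upto (mode_base Df DV \<gamma>) (\<lambda>\<xi>. f (\<xi>, \<gamma>)) (\<lambda>\<xi>. W (\<xi>, \<gamma>)) (ereal \<tau>)"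
      unfolding obs_bwd_upto_def iv
      using z(2) z(3)[of "{-\<tau>..0}"] \<tau> by (auto simp: is_interval_cc intro!: exI[of _ z])
    then show ?thesis using \<tau> by (auto simp: O_bwd_def obs_bwd_def)
  qed
  moreover have "z' 0 \<in> O_fwd Df f DV W \<gamma>'"
  proof -
    have iv: "{t. 0 \<le> t \<and> ereal t \<le> ereal \<tau>} = {0..\<tau>}" by auto
    have "z' 0 \<in> obs_fwd_upto (mode_base Df DV \<gamma>') (\<lambda>\<xi>. f (\<xi>, \<gamma>')) (\<lambda>\<xi>. W (\<xi>, \<gamma>')) (ereal \<tau>)"
      unfolding obs_fwd_upto_def iv
      using z'(2) z'(3)[of "{0..\<tau>}"] \<tau> by (auto simp: is_interval_cc intro!: exI[of _ z'])
    then show ?thesis using \<tau> by (auto simp: O_fwd_def obs_fwd_def)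
  qed
  moreover have "z 0 \<in> level_set DV V \<gamma> (c \<gamma>)" "z' 0 \<in> level_set DV V \<gamma>' (c \<gamma>')"
    using z(2)[of 0] z'(2)[of 0] \<tau> V by (auto simp: level_set_def class_V_def)
  ultimately show thesis using that[OF sr_top \<open>(\<lambda>k. x (s (r k))) \<longlonglongrightarrow> z 0\<close>] unfolding eq by blast
qed

text \<open>The cycle condition with one level per mode is a common consequence of (ii), for
  arbitrary levels, and of (iii), for equal levels, so both cases share this argument.\<close>

lemma trajectory_recurs_near_zero:
  fixes Df :: "('a::euclidean_space \<times> 'g::metric_space) set" and V W :: "'a \<times> 'g \<Rightarrow> real"
  assumes fin: "finite (UNIV :: 'g set)" and Df: "closed Df" "continuous_on Df f"
    and tr: "trajectory Df f (I, x, \<sigma>)" "forward_complete (I, x, \<sigma>)"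
    and \<sigma>: "\<sigma> \<in> signals_d" "\<sigma> \<in> signals_H H"
    and V: "class_V Df DV V"
    and diss: "\<And>\<xi> \<gamma>. \<xi> \<in> mode_base Df DV \<gamma> \<Longrightarrow>
      - frechet_derivative (\<lambda>\<zeta>. V (\<zeta>, \<gamma>)) (at \<xi>) (f (\<xi>, \<gamma>)) \<ge> W (\<xi>, \<gamma>) \<and> W (\<xi>, \<gamma>) \<ge> 0"
    and R: "cball 0 R \<subseteq> base DV" "\<And>t. 0 \<le> t \<Longrightarrow> norm (x t) \<le> R"
    and lim: "\<And>\<gamma>. ((\<lambda>t. V (x t, \<gamma>)) \<longlongrightarrow> c \<gamma>) (inf at_top (principal (\<sigma> -` {\<gamma>})))"
    and obs: "cond_i Df f DV W"
    and cyc: "\<And>m \<gamma>. simple_cycle H m \<gamma> \<Longrightarrow> \<exists>j\<in>{1..m-1}.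
      O_bwd Df f DV W (\<gamma> j) \<inter> O_fwd Df f DV W (\<gamma> (j + 1)) \<inter>
      level_set DV V (\<gamma> j) (c (\<gamma> j)) \<inter> level_set DV V (\<gamma> (j + 1)) (c (\<gamma> (j + 1))) \<subseteq> {0}"
    and e: "0 < e"
  shows "\<exists>t\<ge>T. norm (x t) < e"
proof (rule ccontr)
  assume "\<not> ?thesis"
  then have away: "e \<le> norm (x t)" if "T \<le> t" for t using that by force
  \<comment> \<open>A trajectory that stays at distance e from 0 has only nonzero limits along late
    times; a single such limit in a set contained in {0} is then a contradiction.\<close>
  have limit_nonzero: "\<xi> \<noteq> 0" if "filterlim s at_top sequentially" "(\<lambda>k. x (s k)) \<longlonglongrightarrow> \<xi>" for s \<xi>
  proof -
    have "\<forall>\<^sub>F k in sequentially. T \<le> s k" using that(1) by (simp add: filterlim_at_top)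
    then have "\<forall>\<^sub>F k in sequentially. e \<le> norm (x (s k))" by eventually_elim (rule away)
    then have "e \<le> norm \<xi>" by (intro tendsto_lowerbound[OF tendsto_norm[OF that(2)]]) auto
    then show ?thesis using e by auto
  qed
  show False
  proof (cases "\<exists>\<^sub>F t in at_top. t \<in> jump_times \<sigma>")
    case False
    then obtain T\<^sub>0 where T\<^sub>0: "\<And>t. T\<^sub>0 \<le> t \<Longrightarrow> t \<notin> jump_times \<sigma>"
      by (auto simp: frequently_def eventually_at_top_linorder)
    obtain \<gamma> \<xi> s where "filterlim s at_top sequentially" "(\<lambda>k::nat. x (s k)) \<longlonglongrightarrow> \<xi>"
      "\<xi> \<in> O_fwd_inf Df f DV W \<gamma>" "\<xi> \<in> O_bwd_inf Df f DV W \<gamma>"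
      using finally_constant_signal_limit[where T\<^sub>0 = T\<^sub>0, OF Df tr V diss R lim T\<^sub>0] by metis
    with limit_nonzero obs show False by (auto simp: cond_i_def)
  next
    case True
    obtain m \<gamma> where \<gamma>: "simple_cycle H m \<gamma>"
      "\<And>j. j \<in> {1..m-1} \<Longrightarrow> recurrent_transition \<sigma> (\<gamma> j) (\<gamma> (j + 1))"
      using recurrent_transitions_contain_cycle[OF fin \<sigma> True] by metis
    obtain j where j: "j \<in> {1..m-1}"
      "O_bwd Df f DV W (\<gamma> j) \<inter> O_fwd Df f DV W (\<gamma> (j + 1)) \<inter>
        level_set DV V (\<gamma> j) (c (\<gamma> j)) \<inter> level_set DV V (\<gamma> (j + 1)) (c (\<gamma> (j + 1))) \<subseteq> {0}"
      using cyc[OF \<gamma>(1)] by blast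
    obtain \<xi> s where "filterlim s at_top sequentially" "(\<lambda>k::nat. x (s k)) \<longlonglongrightarrow> \<xi>"
      "\<xi> \<in> O_bwd Df f DV W (\<gamma> j) \<inter> O_fwd Df f DV W (\<gamma> (j + 1)) \<inter>
        level_set DV V (\<gamma> j) (c (\<gamma> j)) \<inter> level_set DV V (\<gamma> (j + 1)) (c (\<gamma> (j + 1)))"
      using recurrent_transition_limit[where c = c, OF fin Df tr \<sigma>(1) V diss R lim \<gamma>(2)[OF j(1)]] by metis
    with limit_nonzero j(2) show False by blast
  qed
qed

subsection \<open>Asymptotic stability\<close>

lemma weak_imp_F_weak_Lyapunov_pair:
  assumes "weak_Lyapunov_pair Df f \<T> DV V W"
  shows "F_weak_Lyapunov_pair Df f \<T> DV V W"
proof -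
  have "antimono_on ({a..b} \<inter> \<sigma> -` {\<gamma>}) (\<lambda>t. V (x t, \<gamma>))"
    if "antimono_on {a..b} (\<lambda>t. V (x t, \<sigma> t))" for a b :: real and x \<sigma> \<gamma>
  proof (rule monotone_onI)
    fix s t assume "s \<in> {a..b} \<inter> \<sigma> -` {\<gamma>}" "t \<in> {a..b} \<inter> \<sigma> -` {\<gamma>}" "s \<le> t"
    then show "V (x t, \<gamma>) \<le> V (x s, \<gamma>)" using monotone_onD[OF that, of s t] by auto
  qed
  then show ?thesis
    using assms unfolding weak_Lyapunov_pair_def F_weak_Lyapunov_pair_def by blast
qed

lemma Lyapunov_nonneg_on_mode_base:
  assumes "pre_Lyapunov_pair Df f DV V W" "\<xi> \<in> mode_base Df DV \<gamma>"
  shows "0 \<le> V (\<xi>, \<gamma>)"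
proof -
  obtain A1 a1 A2 a2 where a: "class_K A1 a1" "sandwiched Df DV V A1 a1 A2 a2"
    using assms(1) by (auto simp: pre_Lyapunov_pair_def)
  have *: "norm \<xi> \<in> A1" "a1 (norm \<xi>) \<le> V (\<xi>, \<gamma>)"
    using a(2) assms(2) by (auto simp: sandwiched_def)
  have "strict_mono_on A1 a1" "a1 0 = 0" "0 \<in> A1" using a(1) by (auto simp: class_K_def)
  then have "0 \<le> a1 (norm \<xi>)"
    using *(1) by (metis norm_ge_zero order_le_less strict_mono_onD)
  with *(2) show ?thesis by simp
qed

text \<open>Condition (iii) only helps for a weak pair, because there the levels \<open>c \<gamma>\<close> reached in the
  individual modes agree; under condition (ii) the levels are irrelevant.\<close>

lemma trajectory_levels:
  fixes Df :: "('a::euclidean_space \<times> 'g::metric_space) set"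
  assumes tr: "trajectory Df f (I, x, \<sigma>)" "forward_complete (I, x, \<sigma>)" and T: "(I, x, \<sigma>) \<in> \<T>"
    and FW: "F_weak_Lyapunov_pair Df f \<T> DV V W"
    and cond: "weak_Lyapunov_pair Df f \<T> DV V W \<and> cond_iii H Df f DV V W \<or> cond_ii H Df f DV W"
    and base: "\<And>t. 0 \<le> t \<Longrightarrow> x t \<in> base DV"
  obtains c where "\<And>\<gamma>. ((\<lambda>t. V (x t, \<gamma>)) \<longlongrightarrow> c \<gamma>) (inf at_top (principal (\<sigma> -` {\<gamma>})))"
    "\<And>m \<gamma>. simple_cycle H m \<gamma> \<Longrightarrow> \<exists>j\<in>{1..m-1}.
      O_bwd Df f DV W (\<gamma> j) \<inter> O_fwd Df f DV W (\<gamma> (j + 1)) \<inter>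
      level_set DV V (\<gamma> j) (c (\<gamma> j)) \<inter> level_set DV V (\<gamma> (j + 1)) (c (\<gamma> (j + 1))) \<subseteq> {0}"
proof -
  have nonneg: "0 \<le> V (x t, \<sigma> t)" if "0 \<le> t" for t
  proof (rule Lyapunov_nonneg_on_mode_base)
    show "pre_Lyapunov_pair Df f DV V W" using FW by (simp add: F_weak_Lyapunov_pair_def)
    have "t \<in> I" using tr(2) that by (auto simp: forward_complete_def)
    then show "x t \<in> mode_base Df DV (\<sigma> t)"
      using tr(1) base[OF that] by (auto simp: trajectory_def mode_base_def slice_def)
  qed
  from cond show thesis
  proof
    assume w: "weak_Lyapunov_pair Df f \<T> DV V W \<and> cond_iii H Df f DV V W"
    have anti: "V (x t, \<sigma> t) \<le> V (x s, \<sigma> s)" if "0 \<le> s" "s \<le> t" for s t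
    proof -
      have "antimono_on {s..t} (\<lambda>t. V (x t, \<sigma> t))"
        using w T base that unfolding weak_Lyapunov_pair_def by fastforce
      then show ?thesis using that by (auto simp: monotone_on_def)
    qed
    \<comment> \<open>For a weak pair the value in the active mode is monotone across switches. Its
      single limit is the level of every mode, as the values coincide while that mode is
      active.\<close>
    obtain c where c: "((\<lambda>t. V (x t, \<sigma> t)) \<longlongrightarrow> c) (inf at_top (principal UNIV))"
      using antimono_nonneg_convergent_along[of UNIV "\<lambda>t. V (x t, \<sigma> t)"] anti nonneg by blast
    have "((\<lambda>t. V (x t, \<gamma>)) \<longlongrightarrow> c) (inf at_top (principal (\<sigma> -` {\<gamma>})))" for \<gamma>
    proof (rule Lim_transform_eventually)
      show "((\<lambda>t. V (x t, \<sigma> t)) \<longlongrightarrow> c) (inf at_top (principal (\<sigma> -` {\<gamma>})))"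
        by (rule tendsto_mono[OF _ c]) (auto intro: le_infI2 le_infI1)
      show "\<forall>\<^sub>F t in inf at_top (principal (\<sigma> -` {\<gamma>})). V (x t, \<sigma> t) = V (x t, \<gamma>)"
        by (auto simp: eventually_inf_principal)
    qed
    with w show thesis by (intro that[of "\<lambda>_. c"]) (auto simp: cond_iii_def)
  next
    assume ii: "cond_ii H Df f DV W"
    have "\<exists>c. ((\<lambda>t. V (x t, \<gamma>)) \<longlongrightarrow> c) (inf at_top (principal (\<sigma> -` {\<gamma>})))" for \<gamma>
    proof -
      have anti: "V (x t, \<gamma>) \<le> V (x s, \<gamma>)" if "0 \<le> s" "s \<le> t" "s \<in> \<sigma> -` {\<gamma>}" "t \<in> \<sigma> -` {\<gamma>}" for s t
      proof -
        have "antimono_on ({s..t} \<inter> \<sigma> -` {\<gamma>}) (\<lambda>t. V (x t, \<gamma>))"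
          using FW T base that unfolding F_weak_Lyapunov_pair_def by fastforce
        then show ?thesis using that by (auto simp: monotone_on_def)
      qed
      have "0 \<le> V (x t, \<gamma>)" if "0 \<le> t" "t \<in> \<sigma> -` {\<gamma>}" for t using nonneg[of t] that by auto
      from antimono_nonneg_convergent_along[of "\<sigma> -` {\<gamma>}" "\<lambda>t. V (x t, \<gamma>)", OF anti this]
      show ?thesis by blast
    qed
    then obtain c where "\<And>\<gamma>. ((\<lambda>t. V (x t, \<gamma>)) \<longlongrightarrow> c \<gamma>) (inf at_top (principal (\<sigma> -` {\<gamma>})))"
      by metis
    then show thesis
    proof (rule that)
      fix m \<gamma> assume "simple_cycle H m \<gamma>"
      then obtain j where "j \<in> {1..m-1}" "O_bwd Df f DV W (\<gamma> j) \<inter> O_fwd Df f DV W (\<gamma> (j + 1)) \<subseteq> {0}"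
        using ii unfolding cond_ii_def by blast
      then show "\<exists>j\<in>{1..m-1}. O_bwd Df f DV W (\<gamma> j) \<inter> O_fwd Df f DV W (\<gamma> (j + 1)) \<inter>
        level_set DV V (\<gamma> j) (c (\<gamma> j)) \<inter> level_set DV V (\<gamma> (j + 1)) (c (\<gamma> (j + 1))) \<subseteq> {0}"
        by blast
    qed
  qed
qed

text \<open>For each e a single visit to a small enough ball suffices: the gain, restarted at that
  time, keeps the state below e from then on. The inclusion of the ball of radius \<beta> r in
  \<open>base DV\<close> confines the whole trajectory to a compact region there.\<close>

lemma gain_imp_convergence:
  fixes Df :: "('a::euclidean_space \<times> 'g::metric_space) set"
  assumes fin: "finite (UNIV :: 'g set)" and Df: "closed Df" "continuous_on Df f"
    and tr: "\<And>I x \<sigma>. (I, x, \<sigma>) \<in> \<T> \<Longrightarrow>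
      trajectory Df f (I, x, \<sigma>) \<and> forward_complete (I, x, \<sigma>) \<and> \<sigma> \<in> signals_d \<inter> signals_H H"
    and FW: "F_weak_Lyapunov_pair Df f \<T> DV V W"
    and obs: "cond_i Df f DV W"
    and cond: "weak_Lyapunov_pair Df f \<T> DV V W \<and> cond_iii H Df f DV V W \<or> cond_ii H Df f DV W"
    and gain: "0 < r" "class_K_inf \<beta>" "gain_on \<T> r \<beta>" "cball 0 (\<beta> r) \<subseteq> base DV"
    and T: "(I, x, \<sigma>) \<in> \<T>" and x0: "norm (x 0) \<le> r"
  shows "(x \<longlongrightarrow> 0) at_top"
proof (rule tendstoI)
  fix e :: real assume "0 < e"
  note tr = tr[OF T]
  have gainD: "norm (x t) \<le> \<beta> (norm (x t\<^sub>0))" if "0 \<le> t\<^sub>0" "norm (x t\<^sub>0) \<le> r" "t\<^sub>0 \<le> t" for t\<^sub>0 t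
    using gain(3) T that unfolding gain_on_def by blast
  have bounded: "norm (x t) \<le> \<beta> r" if "0 \<le> t" for t
    using gainD[of 0 t] that x0 class_K_infD(4)[OF gain(2), of "norm (x 0)" r] by auto
  have base: "x t \<in> base DV" if "0 \<le> t" for t using bounded[OF that] gain(4) by auto
  have pre: "class_V Df DV V" "\<And>\<xi> \<gamma>. \<xi> \<in> mode_base Df DV \<gamma> \<Longrightarrow>
      - frechet_derivative (\<lambda>\<zeta>. V (\<zeta>, \<gamma>)) (at \<xi>) (f (\<xi>, \<gamma>)) \<ge> W (\<xi>, \<gamma>) \<and> W (\<xi>, \<gamma>) \<ge> 0"
    using FW by (auto simp: F_weak_Lyapunov_pair_def pre_Lyapunov_pair_def)
  obtain c where c: "\<And>\<gamma>. ((\<lambda>t. V (x t, \<gamma>)) \<longlongrightarrow> c \<gamma>) (inf at_top (principal (\<sigma> -` {\<gamma>})))"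
    "\<And>m \<gamma>. simple_cycle H m \<gamma> \<Longrightarrow> \<exists>j\<in>{1..m-1}.
      O_bwd Df f DV W (\<gamma> j) \<inter> O_fwd Df f DV W (\<gamma> (j + 1)) \<inter>
      level_set DV V (\<gamma> j) (c (\<gamma> j)) \<inter> level_set DV V (\<gamma> (j + 1)) (c (\<gamma> (j + 1))) \<subseteq> {0}"
    using trajectory_levels[OF _ _ T FW cond base] tr by blast
  obtain d where d: "0 < d" "\<And>s. 0 \<le> s \<Longrightarrow> s \<le> d \<Longrightarrow> \<beta> s < e"
    using class_K_inf_small[OF gain(2) \<open>0 < e\<close>] by blast
  \<comment> \<open>Below d the gain is smaller than e, and below r it may be restarted at
    \<open>t\<^sub>0\<close>.\<close>
  obtain t\<^sub>0 where t0: "0 \<le> t\<^sub>0" "norm (x t\<^sub>0) < min d r"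
    using trajectory_recurs_near_zero[where V = V and W = W and T = 0 and e = "min d r",
        OF fin Df _ _ _ _ pre gain(4) bounded c(1) obs c(2)] tr d(1) gain(1) by auto
  have "norm (x t) < e" if "t\<^sub>0 \<le> t" for t
    using gainD[OF t0(1) _ that] d(2)[of "norm (x t\<^sub>0)"] t0(2) by force
  then show "\<forall>\<^sub>F t in at_top. dist (x t) 0 < e"
    by (auto simp: eventually_at_top_linorder)
qed

theorem theorem4p6:
  fixes Df :: "('a::euclidean_space \<times> 'g::metric_space) set"
    and f :: "'a \<times> 'g \<Rightarrow> 'a"
    and H :: "'g \<Rightarrow> 'g set"
    and \<T> :: "('a, 'g) traj set"
  assumes "finite (UNIV :: 'g set)"
    and "closed Df" and "continuous_on Df f"
    and "\<And>\<gamma>. 0 \<in> slice Df \<gamma> \<Longrightarrow> f (0, \<gamma>) = 0"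
    and "\<And>I x \<sigma>. (I, x, \<sigma>) \<in> \<T> \<Longrightarrow>
      trajectory Df f (I, x, \<sigma>) \<and> forward_complete (I, x, \<sigma>) \<and> \<sigma> \<in> signals_d \<inter> signals_H H"
  shows "((\<exists>DV V W. weak_Lyapunov_pair Df f \<T> DV V W \<and> cond_i Df f DV W \<and> cond_iii H Df f DV V W) \<or>
         (\<exists>DV V W. F_weak_Lyapunov_pair Df f \<T> DV V W \<and> cond_i Df f DV W \<and> cond_ii H Df f DV W)
         \<longrightarrow> LAS \<T>) \<and>
         ((\<exists>DV V W. weak_Lyapunov_pair Df f \<T> DV V W \<and> cond_i Df f DV W \<and> cond_iii H Df f DV V W \<and>
            base DV = UNIV \<and> radially_unbounded Df DV V) \<or>
         (\<exists>DV V W. F_weak_Lyapunov_pair Df f \<T> DV V W \<and> cond_i Df f DV W \<and> cond_ii H Df f DV W \<and>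
            base DV = UNIV \<and> radially_unbounded Df DV V)
         \<longrightarrow> GAS \<T>)"
proof -
  have fc: "trajectory Df f (I, x, \<sigma>) \<and> forward_complete (I, x, \<sigma>)" if "(I, x, \<sigma>) \<in> \<T>" for I x \<sigma>
    using assms(5)[OF that] by blast
  note convergence = gain_imp_convergence[OF assms(1-3,5)]
  \<comment> \<open>Both cases of the theorem are merged here: a weak pair with (iii) enters through
    its F-weak property and the first alternative of the condition. The radius r of the gain also
    serves as radius of attraction.\<close>
  have LAS: "LAS \<T>"
    if FW: "F_weak_Lyapunov_pair Df f \<T> DV V W" and obs: "cond_i Df f DV W"
      and cond: "weak_Lyapunov_pair Df f \<T> DV V W \<and> cond_iii H Df f DV V W \<or> cond_ii H Df f DV W"
    for DV V W
  proof -
    obtain r \<beta> where g: "0 < r" "class_K_inf \<beta>" "cball 0 (\<beta> r) \<subseteq> base DV" "gain_on \<T> r \<beta>"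
      using F_weak_local_gain[OF assms(1) fc FW] by blast
    have "LUS \<T>"
      unfolding LUS_def
    proof (intro exI[of _ r] exI[of _ \<beta>] conjI g(1) class_K_inf_restrict[OF g(2,1)])
      show "\<forall>(I, x, \<sigma>)\<in>\<T>. \<forall>t\<^sub>0\<ge>0. norm (x t\<^sub>0) \<le> r \<longrightarrow> (\<forall>t\<ge>t\<^sub>0. norm (x t) \<le> \<beta> (norm (x t\<^sub>0)))"
        using g(4) unfolding gain_on_def by blast
    qed
    moreover have "(x \<longlongrightarrow> 0) at_top" if "(I, x, \<sigma>) \<in> \<T>" "norm (x 0) < r" for I x \<sigma>
      using convergence[OF _ FW obs cond g(1,2,4,3)] that by force
    ultimately show ?thesis
      unfolding LAS_def using g(1) by blast
  qed
  have GAS: "GAS \<T>"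
    if FW: "F_weak_Lyapunov_pair Df f \<T> DV V W" and obs: "cond_i Df f DV W"
      and cond: "weak_Lyapunov_pair Df f \<T> DV V W \<and> cond_iii H Df f DV V W \<or> cond_ii H Df f DV W"
      and glob: "base DV = UNIV" "radially_unbounded Df DV V"
    for DV V W
  proof -
    obtain \<beta> where g: "class_K_inf \<beta>" "\<And>r. gain_on \<T> r \<beta>"
      using F_weak_global_gain[OF assms(1) fc FW glob] by blast
    have "GUS \<T>"
      unfolding GUS_def using g by (intro exI[of _ \<beta>]) (fastforce simp: gain_on_def)
    moreover have "(x \<longlongrightarrow> 0) at_top" if "(I, x, \<sigma>) \<in> \<T>" for I x \<sigma>
      \<comment> \<open>The gain holds for every radius, so one adapted to the trajectory is
        allowed; the + 1 makes it positive.\<close>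
      by (rule convergence[OF _ FW obs cond _ g(1,2) _ that, of "norm (x 0) + 1"])
        (use glob(1) in \<open>auto intro: add_nonneg_pos\<close>)
    ultimately show ?thesis unfolding GAS_def by blast
  qed
  show ?thesis
    using LAS GAS weak_imp_F_weak_Lyapunov_pair by blast
qed

end
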